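(* Let $\mathcal{B} \subset \mathcal{A}$ be an inclusion of simple unital $C^*$-algebras such that there exists a finite-index conditional expectation from $\mathcal{A}$ onto $\mathcal{B}$, and let $\mathcal{C} := C^*(\mathcal{B} \cup \mathcal{C}_{\mathcal{A}}(\mathcal{B}))$ be the intermediate $C^*$-subalgebra generated by $\mathcal{B}$ and its centralizer $\mathcal{C}_{\mathcal{A}}(\mathcal{B})$. Then the inclusion $\mathcal{B} \subset \mathcal{A}$ is regular if and only if there exists a finite group $G$ that admits a cocycle action $(\alpha, \sigma)$ on $\mathcal{C}$ such that (1) $\mathcal{B}$ is invariant under $\alpha$; (2) for each $e \neq g \in G$, $\alpha_g$ (restricted to $\mathcal{B}$) is an outer automorphism of $\mathcal{B}$; and (3) $(\mathcal{B} \subset \mathcal{A}) \cong (\mathcal{B} \subset \mathcal{C} \rtimes^r_{(\alpha,\sigma)} G)$.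
   Context: Inclusions of unital $C^*$-algebras have a common unit. A conditional expectation $E: \mathcal{A} \to \mathcal{B}$ has finite index (in the sense of Watatani) if there is a finite set $\{\lambda_1, \dots, \lambda_n\} \subset \mathcal{A}$ with $x = \sum_i E(x\lambda_i)\lambda_i^*$ for all $x \in \mathcal{A}$. The centralizer is $\mathcal{C}_{\mathcal{A}}(\mathcal{B}) = \{x \in \mathcal{A} : xb = bx \text{ for all } b \in \mathcal{B}\}$. The normalizer is $\mathcal{N}_{\mathcal{A}}(\mathcal{B}) = \{u \in \mathcal{U}(\mathcal{A}) : u\mathcal{B}u^* = \mathcal{B}\}$, where $\mathcal{U}(\cdot)$ denotes the unitary group. The inclusion $\mathcal{B} \subset \mathcal{A}$ is regular if $\mathcal{N}_{\mathcal{A}}(\mathcal{B})$ generates $\mathcal{A}$ as a $C^*$-algebra. A cocycle action (twisted action) of a discrete group $G$ on a unital $C^*$-algebra $\mathcal{C}$ is a pair $(\alpha, \sigma)$ of maps $\alpha: G \to \mathrm{Aut}(\mathcal{C})$ and $\sigma: G \times G \to \mathcal{U}(\mathcal{C})$ such that, for all $g,h,k \in G$, $\alpha_g \circ \alpha_h = \mathrm{Ad}(\sigma(g,h)) \circ \alpha_{gh}$, $\sigma(g,h)\sigma(gh,k) = \alpha_g(\sigma(h,k))\sigma(g,hk)$, and $\sigma(g,e) = \sigma(e,g) = 1$. The reduced twisted crossed product $\mathcal{C} \rtimes^r_{(\alpha,\sigma)} G$ is the $C^*$-algebra generated by a copy of $\mathcal{C}$ and unitaries $u_g$ ($g \in G$)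 with $u_g u_h = \sigma(g,h)u_{gh}$ and $u_g x u_g^* = \alpha_g(x)$ for $x \in \mathcal{C}$, carrying a faithful conditional expectation onto $\mathcal{C}$ that vanishes on $u_g$ for $g \neq e$. For finite $G$, it equals $\{\sum_{g \in G} x_g u_g : x_g \in \mathcal{C}\}$, with the coefficients $x_g$ uniquely determined. An automorphism is outer if it is not inner, i.e. not of the form $\mathrm{Ad}(v)$ with $v$ a unitary of the algebra. The notation $(\mathcal{B} \subset \mathcal{A}) \cong (\mathcal{B} \subset \mathcal{D})$ means that there is a $*$-isomorphism of $\mathcal{A}$ onto $\mathcal{D}$ carrying $\mathcal{B}$ onto $\mathcal{B}$. *)

theory Defs
  imports "HOL-Analysis.Analysis" "HOL-Algebra.Ring"
begin

section \<open>Unital C*-algebras\<close>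

text \<open>
  A type of the class below is a nonzero unital C*-algebra; the norm is complete by \<open>banach\<close> and
  submultiplicative with \<open>norm 1 = 1\<close> by \<open>real_normed_algebra_1\<close>.
\<close>

class cstar_algebra = real_normed_algebra_1 + banach +
  fixes scaleC :: "complex \<Rightarrow> 'a \<Rightarrow> 'a"  (infixr \<open>*\<^sub>C\<close> 75)
    and star :: "'a \<Rightarrow> 'a"
  assumes scaleC_add_right: "c *\<^sub>C (x + y) = c *\<^sub>C x + c *\<^sub>C y"
    and scaleC_add_left: "(c + d) *\<^sub>C x = c *\<^sub>C x + d *\<^sub>C x"
    and scaleC_scaleC: "c *\<^sub>C d *\<^sub>C x = (c * d) *\<^sub>C x"
    and scaleR_scaleC: "r *\<^sub>R x = complex_of_real r *\<^sub>C x"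
    and mult_scaleC_left: "(c *\<^sub>C x) * y = c *\<^sub>C (x * y)"
    and mult_scaleC_right: "x * (c *\<^sub>C y) = c *\<^sub>C (x * y)"
    and norm_scaleC: "norm (c *\<^sub>C x) = cmod c * norm x"
    and star_add: "star (x + y) = star x + star y"
    and star_scaleC: "star (c *\<^sub>C x) = cnj c *\<^sub>C star x"
    and star_mult: "star (x * y) = star y * star x"
    and star_star: "star (star x) = x"
    and cstar_identity: "norm (star x * x) = (norm x)\<^sup>2"

instantiation complex :: cstar_algebra
begin

definition scaleC_complex :: "complex \<Rightarrow> complex \<Rightarrow> complex" where
  "scaleC_complex c x = c * x"

definition star_complex :: "complex \<Rightarrow> complex" where
  "star_complex x = cnj x"

instance
  by standard
    (auto simp: scaleC_complex_def star_complex_def algebra_simps scaleR_conv_of_real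
      norm_mult power2_eq_square)

end

definition cstar_subalgebra :: "'a::cstar_algebra set \<Rightarrow> bool" where
  "cstar_subalgebra S \<longleftrightarrow>
     closed S \<and> 0 \<in> S \<and>
     (\<forall>x\<in>S. \<forall>y\<in>S. x + y \<in> S) \<and>
     (\<forall>c. \<forall>x\<in>S. c *\<^sub>C x \<in> S) \<and>
     (\<forall>x\<in>S. \<forall>y\<in>S. x * y \<in> S) \<and>
     (\<forall>x\<in>S. star x \<in> S)"

text \<open>The unit of the subalgebra is that of the ambient algebra.\<close>

definition unital_cstar_subalgebra :: "'a::cstar_algebra set \<Rightarrow> bool" where
  "unital_cstar_subalgebra S \<longleftrightarrow> cstar_subalgebra S \<and> 1 \<in> S"

definition cstar_generated :: "'a::cstar_algebra set \<Rightarrow> 'a set" where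
  "cstar_generated X = \<Inter>{S. cstar_subalgebra S \<and> X \<subseteq> S}"

definition closed_ideal :: "'a::cstar_algebra set \<Rightarrow> 'a set \<Rightarrow> bool" where
  "closed_ideal S J \<longleftrightarrow>
     J \<subseteq> S \<and> closed J \<and> 0 \<in> J \<and>
     (\<forall>x\<in>J. \<forall>y\<in>J. x + y \<in> J) \<and>
     (\<forall>c. \<forall>x\<in>J. c *\<^sub>C x \<in> J) \<and>
     (\<forall>s\<in>S. \<forall>x\<in>J. s * x \<in> J \<and> x * s \<in> J)"

definition simple_cstar :: "'a::cstar_algebra set \<Rightarrow> bool" where
  "simple_cstar S \<longleftrightarrow> S \<noteq> {0} \<and> (\<forall>J. closed_ideal S J \<longrightarrow> J = {0} \<or> J = S)"

definition unitaries :: "'a::cstar_algebra set \<Rightarrow> 'a set" where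
  "unitaries S = {u \<in> S. star u * u = 1 \<and> u * star u = 1}"

definition positive_in :: "'a::cstar_algebra set \<Rightarrow> 'a \<Rightarrow> bool" where
  "positive_in S a \<longleftrightarrow> (\<exists>y\<in>S. a = star y * y)"


section \<open>Inclusions\<close>

text \<open>In the following, the larger algebra is the whole type.\<close>

definition conditional_expectation :: "'a::cstar_algebra set \<Rightarrow> ('a \<Rightarrow> 'a) \<Rightarrow> bool" where
  "conditional_expectation B E \<longleftrightarrow>
     (\<forall>x. E x \<in> B) \<and> (\<forall>b\<in>B. E b = b) \<and>
     (\<forall>x y. E (x + y) = E x + E y) \<and>
     (\<forall>c x. E (c *\<^sub>C x) = c *\<^sub>C E x) \<and>
     (\<forall>x. \<forall>b\<in>B. \<forall>b'\<in>B. E (b * x * b') = b * E x * b') \<and>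
     (\<forall>x. positive_in UNIV x \<longrightarrow> positive_in B (E x))"

definition finite_index :: "('a::cstar_algebra \<Rightarrow> 'a) \<Rightarrow> bool" where
  "finite_index E \<longleftrightarrow>
     (\<exists>(n::nat) l. \<forall>x. x = (\<Sum>i<n. E (x * l i) * star (l i)))"

definition centralizer :: "'a::cstar_algebra set \<Rightarrow> 'a set" where
  "centralizer B = {x. \<forall>b\<in>B. x * b = b * x}"

definition normalizer :: "'a::cstar_algebra set \<Rightarrow> 'a set" where
  "normalizer B = {u \<in> unitaries UNIV. (\<lambda>b. u * b * star u) ` B = B}"

definition regular_inclusion :: "'a::cstar_algebra set \<Rightarrow> bool" where
  "regular_inclusion B \<longleftrightarrow> cstar_generated (normalizer B) = UNIV"


section \<open>Isomorphisms\<close>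

text \<open>
  The crossed product lives on a carrier set of functions rather than on a type of class
  \<open>cstar_algebra\<close>, so isomorphisms are stated between records.  As usual, a *-isomorphism is a
  bijective *-homomorphism; it is not required to be isometric, since between C*-algebras this is
  automatic.
\<close>

record 'a cstar = "'a ring" +
  scal :: "complex \<Rightarrow> 'a \<Rightarrow> 'a"
  adj :: "'a \<Rightarrow> 'a"
  nrm :: "'a \<Rightarrow> real"

definition cstar_of :: "'a::cstar_algebra set \<Rightarrow> 'a cstar" where
  "cstar_of S = \<lparr>carrier = S, mult = (*), one = 1, zero = 0, add = (+),
                 scal = scaleC, adj = star, nrm = norm\<rparr>"

definition star_isomorphism :: "'a cstar \<Rightarrow> 'b cstar \<Rightarrow> ('a \<Rightarrow> 'b) \<Rightarrow> bool" where
  "star_isomorphism A D \<phi> \<longleftrightarrow>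
     bij_betw \<phi> (carrier A) (carrier D) \<and>
     (\<forall>x\<in>carrier A. \<forall>y\<in>carrier A. \<phi> (x \<oplus>\<^bsub>A\<^esub> y) = \<phi> x \<oplus>\<^bsub>D\<^esub> \<phi> y) \<and>
     (\<forall>c. \<forall>x\<in>carrier A. \<phi> (scal A c x) = scal D c (\<phi> x)) \<and>
     (\<forall>x\<in>carrier A. \<forall>y\<in>carrier A. \<phi> (x \<otimes>\<^bsub>A\<^esub> y) = \<phi> x \<otimes>\<^bsub>D\<^esub> \<phi> y) \<and>
     (\<forall>x\<in>carrier A. \<phi> (adj A x) = adj D (\<phi> x))"

definition inclusion_isomorphic :: "'a set \<Rightarrow> 'a cstar \<Rightarrow> 'b set \<Rightarrow> 'b cstar \<Rightarrow> bool" where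
  "inclusion_isomorphic B A B' D \<longleftrightarrow> (\<exists>\<phi>. star_isomorphism A D \<phi> \<and> \<phi> ` B = B')"

text \<open>An automorphism of \<open>S\<close> is a function on the ambient type of which only the values on
  \<open>S\<close> matter.\<close>

definition automorphism :: "'a::cstar_algebra set \<Rightarrow> ('a \<Rightarrow> 'a) \<Rightarrow> bool" where
  "automorphism S \<theta> \<longleftrightarrow> star_isomorphism (cstar_of S) (cstar_of S) \<theta>"

definition inner_automorphism :: "'a::cstar_algebra set \<Rightarrow> ('a \<Rightarrow> 'a) \<Rightarrow> bool" where
  "inner_automorphism S \<theta> \<longleftrightarrow> (\<exists>v\<in>unitaries S. \<forall>x\<in>S. \<theta> x = v * x * star v)"

definition outer_automorphism :: "'a::cstar_algebra set \<Rightarrow> ('a \<Rightarrow> 'a) \<Rightarrow> bool" where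
  "outer_automorphism S \<theta> \<longleftrightarrow> automorphism S \<theta> \<and> \<not> inner_automorphism S \<theta>"


section \<open>Cocycle actions and twisted crossed products\<close>

definition cocycle_action ::
  "'g monoid \<Rightarrow> 'a::cstar_algebra set \<Rightarrow> ('g \<Rightarrow> 'a \<Rightarrow> 'a) \<Rightarrow> ('g \<Rightarrow> 'g \<Rightarrow> 'a) \<Rightarrow> bool" where
  "cocycle_action G C \<alpha> \<sigma> \<longleftrightarrow>
     (\<forall>g\<in>carrier G. automorphism C (\<alpha> g)) \<and>
     (\<forall>g\<in>carrier G. \<forall>h\<in>carrier G. \<sigma> g h \<in> unitaries C) \<and>
     (\<forall>g\<in>carrier G. \<forall>h\<in>carrier G. \<forall>x\<in>C.
        \<alpha> g (\<alpha> h x) = \<sigma> g h * \<alpha> (g \<otimes>\<^bsub>G\<^esub> h) x * star (\<sigma> g h)) \<and>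
     (\<forall>g\<in>carrier G. \<forall>h\<in>carrier G. \<forall>k\<in>carrier G.
        \<sigma> g h * \<sigma> (g \<otimes>\<^bsub>G\<^esub> h) k = \<alpha> g (\<sigma> h k) * \<sigma> g (h \<otimes>\<^bsub>G\<^esub> k)) \<and>
     (\<forall>g\<in>carrier G. \<sigma> g \<one>\<^bsub>G\<^esub> = 1 \<and> \<sigma> \<one>\<^bsub>G\<^esub> g = 1)"

text \<open>
  For a finite group \<open>G\<close>, the element \<open>\<Sum>\<^sub>g x\<^sub>g u\<^sub>g\<close> of the (reduced) twisted crossed product is
  represented by its family of coefficients \<open>x : G \<rightarrow> C\<close>.  The relations
  \<open>u\<^sub>g u\<^sub>h = \<sigma>(g,h) u\<^sub>g\<^sub>h\<close> and \<open>u\<^sub>g x u\<^sub>g\<^sup>* = \<alpha>\<^sub>g(x)\<close> give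
  \<open>(x u\<^sub>g)(y u\<^sub>h) = x \<alpha>\<^sub>g(y) \<sigma>(g,h) u\<^sub>g\<^sub>h\<close> and, with \<open>k = g\<^sup>-\<^sup>1\<close>,
  \<open>(x u\<^sub>g)\<^sup>* = \<sigma>(k,g)\<^sup>* \<alpha>\<^sub>k(x\<^sup>*) u\<^sub>k\<close>.
\<close>

definition cp_mult ::
  "'g monoid \<Rightarrow> ('g \<Rightarrow> 'a \<Rightarrow> 'a) \<Rightarrow> ('g \<Rightarrow> 'g \<Rightarrow> 'a) \<Rightarrow> ('g \<Rightarrow> 'a) \<Rightarrow> ('g \<Rightarrow> 'a) \<Rightarrow>
     ('g \<Rightarrow> 'a::cstar_algebra)" where
  "cp_mult G \<alpha> \<sigma> x y =
     (\<lambda>k\<in>carrier G. \<Sum>g\<in>carrier G.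
        x g * \<alpha> g (y (inv\<^bsub>G\<^esub> g \<otimes>\<^bsub>G\<^esub> k)) * \<sigma> g (inv\<^bsub>G\<^esub> g \<otimes>\<^bsub>G\<^esub> k))"

definition cp_star ::
  "'g monoid \<Rightarrow> ('g \<Rightarrow> 'a \<Rightarrow> 'a) \<Rightarrow> ('g \<Rightarrow> 'g \<Rightarrow> 'a) \<Rightarrow> ('g \<Rightarrow> 'a) \<Rightarrow>
     ('g \<Rightarrow> 'a::cstar_algebra)" where
  "cp_star G \<alpha> \<sigma> x =
     (\<lambda>k\<in>carrier G. star (\<sigma> k (inv\<^bsub>G\<^esub> k)) * \<alpha> k (star (x (inv\<^bsub>G\<^esub> k))))"

text \<open>The copy \<open>c u\<^sub>e\<close> of an element \<open>c\<close> of the coefficient algebra.\<close>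

definition cp_embed :: "'g monoid \<Rightarrow> 'a::cstar_algebra \<Rightarrow> ('g \<Rightarrow> 'a)" where
  "cp_embed G c = (\<lambda>g\<in>carrier G. if g = \<one>\<^bsub>G\<^esub> then c else 0)"

text \<open>
  The canonical conditional expectation is \<open>x \<mapsto> x \<one>\<close>.  It yields the norm
  \<open>\<parallel>E(x\<^sup>* x)\<parallel>\<^sup>1\<^sup>/\<^sup>2\<close> of the regular Hilbert C*-module, and the C*-norm of the crossed product is
  the operator norm of left multiplication on that module.
\<close>

definition cp_module_norm ::
  "'g monoid \<Rightarrow> ('g \<Rightarrow> 'a \<Rightarrow> 'a) \<Rightarrow> ('g \<Rightarrow> 'g \<Rightarrow> 'a) \<Rightarrow> ('g \<Rightarrow> 'a::cstar_algebra) \<Rightarrow> real" where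
  "cp_module_norm G \<alpha> \<sigma> x = sqrt (norm (cp_mult G \<alpha> \<sigma> (cp_star G \<alpha> \<sigma> x) x \<one>\<^bsub>G\<^esub>))"

definition crossed_product ::
  "'a::cstar_algebra set \<Rightarrow> 'g monoid \<Rightarrow> ('g \<Rightarrow> 'a \<Rightarrow> 'a) \<Rightarrow> ('g \<Rightarrow> 'g \<Rightarrow> 'a) \<Rightarrow>
     ('g \<Rightarrow> 'a) cstar" where
  "crossed_product C G \<alpha> \<sigma> =
     \<lparr>carrier = carrier G \<rightarrow>\<^sub>E C,
      mult = cp_mult G \<alpha> \<sigma>,
      one = cp_embed G 1,
      zero = cp_embed G 0,
      add = (\<lambda>x y. \<lambda>g\<in>carrier G. x g + y g),
      scal = (\<lambda>c x. \<lambda>g\<in>carrier G. c *\<^sub>C x g),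
      adj = cp_star G \<alpha> \<sigma>,
      nrm = (\<lambda>x. SUP y \<in> {y \<in> carrier G \<rightarrow>\<^sub>E C. cp_module_norm G \<alpha> \<sigma> y \<le> 1}.
                   cp_module_norm G \<alpha> \<sigma> (cp_mult G \<alpha> \<sigma> x y))\<rparr>"

end

theory Submission
  imports Defs "HOL-Algebra.Weak_Morphisms"
begin

text \<open>
  Let \<open>E : A \<rightarrow> B\<close> have finite index with quasi-basis \<open>l\<^sub>i\<close>, and let \<open>R\<close> be the centralizer and \<open>N\<close>
  the normalizer of \<open>B\<close>.

  Suppose that \<open>N\<close> generates \<open>A\<close>. Call two elements \<open>u, v\<close> of \<open>N\<close> equivalent if \<open>u v\<^sup>*\<close> acts on
  \<open>B\<close> as an inner automorphism. The classes form a group \<open>G\<close>; with representatives \<open>u\<^sub>g\<close>, put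
  \<open>\<alpha>\<^sub>g(x) = u\<^sub>g x u\<^sub>g\<^sup>*\<close> and \<open>\<sigma>(g,h) = u\<^sub>g u\<^sub>h u\<^sub>g\<^sub>h\<^sup>*\<close>. An element of \<open>N\<close> acting on \<open>B\<close> like a unitary \<open>w\<close> of
  \<open>B\<close> lies in \<open>w R\<close>, so \<open>\<sigma>\<close> has values in \<open>C\<close>, and the identities of a cocycle action hold by
  cancellation. What is left is that \<open>G\<close> is finite and that every \<open>x\<close> is \<open>\<Sum>\<^sub>g x\<^sub>g u\<^sub>g\<close> for unique
  \<open>x\<^sub>g \<in> C\<close>. Three facts give this.

  \<^item> If \<open>u \<in> N\<close> acts on \<open>B\<close> by an outer automorphism, then \<open>E(c u) = 0\<close> for \<open>c \<in> C\<close>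
    (\<open>E_C_mult_outer\<close>). Indeed, for \<open>r \<in> R\<close> the element \<open>t = E(r u)\<close> satisfies \<open>t b = (u b u\<^sup>*) t\<close>; as
    the centre of a simple algebra is trivial (\<open>central_scalar\<close>), a nonzero such \<open>t\<close> is a multiple
    of a unitary, which would implement the automorphism (\<open>intertwiner_inner\<close>).

  \<^item> Call \<open>V\<close> orthonormal if \<open>E(v\<^sup>* w)\<close> is \<open>1\<close> for \<open>v = w\<close> and \<open>0\<close> otherwise. Finite index gives
    \<open>\<parallel>\<Sum> v v\<^sup>*\<parallel> \<le> \<kappa>\<^sup>2\<close> with a constant independent of \<open>V\<close> (\<open>orthonormal_bound\<close>). Unitaries from distinct
    classes are orthonormal up to adjoints, so there are at most \<open>\<kappa>\<^sup>2\<close> classes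
    (\<open>finite_normalizer_classes\<close>).

  \<^item> The same bound shows that \<open>R\<close> has a finite orthonormal basis \<open>V\<close>
    (\<open>centralizer_orthonormal_basis\<close>). Then \<open>x \<mapsto> \<Sum> v E(v\<^sup>* x)\<close> is a bounded projection \<open>P\<close> onto \<open>C\<close>,
    and the coefficients must be \<open>x\<^sub>g = P(x u\<^sub>g\<^sup>*)\<close>. The \<open>x\<close> that equal \<open>\<Sum>\<^sub>g P(x u\<^sub>g\<^sup>*) u\<^sub>g\<close> form a closed
    *-algebra containing \<open>N\<close>, that is, all of \<open>A\<close>.

  Conversely, let \<open>\<phi>\<close> be an isomorphism of \<open>A\<close> onto a crossed product carrying \<open>B\<close> onto the copy
  of \<open>B\<close>. Nothing is assumed about \<open>\<phi>\<close> on \<open>C\<close>, but \<open>\<rho>(c) = \<phi>\<^sup>-\<^sup>1(c u\<^sub>e)\<close> is a *-homomorphism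
  \<open>C \<rightarrow> A\<close> with \<open>\<rho>(B) = B\<close>. Hence it maps unitaries of \<open>R\<close> to unitaries of \<open>R\<close>, which normalize \<open>B\<close>.
  Since \<open>\<rho>\<close> is bounded, it maps \<open>C\<close> into every C*-algebra containing the normalizer. The elements
  \<open>\<phi>\<^sup>-\<^sup>1(u\<^sub>g)\<close> normalize \<open>B\<close> because \<open>\<alpha>\<^sub>g(B) = B\<close>, and together these elements generate \<open>A\<close>.

  The C*-algebra theory behind these steps is obtained without spectral theory, from the power
  series of \<open>sqrt (1 - x)\<close>. It yields square roots of positive elements, and it exhibits a
  selfadjoint contraction \<open>h\<close> as the real part of the unitary \<open>h + i sqrt (1 - h\<^sup>2)\<close>, which replaces
  the spectral radius in all norm estimates.
\<close>

section \<open>Algebraic rules for the involution and the scalars\<close>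

lemma scaleC_zero_left [simp]: "0 *\<^sub>C x = (0::'a::cstar_algebra)"
  using scaleR_scaleC[of 0 x] by simp

lemma scaleC_zero_right [simp]: "c *\<^sub>C 0 = (0::'a::cstar_algebra)"
  using scaleC_add_right[of c 0 "0::'a"] by simp

lemma scaleC_one [simp]: "1 *\<^sub>C x = (x::'a::cstar_algebra)"
  using scaleR_scaleC[of 1 x] by simp

lemma scaleC_minus_right [simp]: "c *\<^sub>C (- x) = - (c *\<^sub>C (x::'a::cstar_algebra))"
  using scaleC_add_right[of c x "- x"] by (simp add: eq_neg_iff_add_eq_0 add.commute)

lemma scaleC_minus_left [simp]: "(- c) *\<^sub>C x = - (c *\<^sub>C (x::'a::cstar_algebra))"
  using scaleC_add_left[of c "- c" x] by (simp add: eq_neg_iff_add_eq_0 add.commute)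

lemma scaleC_diff_right: "c *\<^sub>C (x - y) = c *\<^sub>C x - c *\<^sub>C (y::'a::cstar_algebra)"
  using scaleC_add_right[of c x "- y"] by simp

lemma scaleC_sum_right: "c *\<^sub>C sum f A = (\<Sum>i\<in>A. c *\<^sub>C (f i :: 'a::cstar_algebra))"
  by (induction A rule: infinite_finite_induct) (auto simp: scaleC_add_right)

lemma scaleC_eq_0_iff [simp]: "c *\<^sub>C x = 0 \<longleftrightarrow> c = 0 \<or> x = (0::'a::cstar_algebra)"
proof -
  have "norm (c *\<^sub>C x) = 0 \<longleftrightarrow> c = 0 \<or> x = 0" unfolding norm_scaleC by simp
  then show ?thesis by simp
qed

lemma star_zero [simp]: "star (0::'a::cstar_algebra) = 0"
  using star_add[of 0 "0::'a"] by simp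

lemma star_minus [simp]: "star (- x) = - star (x::'a::cstar_algebra)"
  using star_add[of x "- x"] by (simp add: eq_neg_iff_add_eq_0 add.commute)

lemma star_diff [simp]: "star (x - y) = star x - star (y::'a::cstar_algebra)"
  using star_add[of x "- y"] by simp

lemma star_sum [simp]: "star (sum f A) = (\<Sum>i\<in>A. star (f i :: 'a::cstar_algebra))"
  by (induction A rule: infinite_finite_induct) (auto simp: star_add)

lemma star_scaleR [simp]: "star (r *\<^sub>R x) = r *\<^sub>R star (x::'a::cstar_algebra)"
  by (simp add: scaleR_scaleC star_scaleC)

lemma star_one [simp]: "star (1::'a::cstar_algebra) = 1"
  by (metis mult_1 mult_1_right star_mult star_star)

declare star_star [simp] star_mult [simp] star_add [simp] star_scaleC [simp]
  mult_scaleC_left [simp] mult_scaleC_right [simp]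

lemma star_power [simp]: "star (x ^ n) = star (x::'a::cstar_algebra) ^ n"
  by (induction n) (simp_all add: power_commutes)

lemma star_eq_iff [simp]: "star x = star y \<longleftrightarrow> x = (y::'a::cstar_algebra)"
  by (metis star_star)

lemma norm_star [simp]: "norm (star x) = norm (x::'a::cstar_algebra)"
proof -
  have *: "norm y \<le> norm (star y)" for y :: 'a
  proof (cases "y = 0")
    case False
    have "norm y * norm y \<le> norm (star y) * norm y"
      using norm_mult_ineq[of "star y" y] by (simp add: cstar_identity power2_eq_square)
    then show ?thesis using False by simp
  qed simp
  show ?thesis using *[of x] *[of "star x"] by simp
qed

lemma bounded_linear_star: "bounded_linear (star :: 'a::cstar_algebra \<Rightarrow> 'a)"
  by (rule bounded_linear_intro[where K = 1]) auto

lemma star_mult_self_eq_0_iff [simp]: "star x * x = 0 \<longleftrightarrow> x = (0::'a::cstar_algebra)"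
  using cstar_identity[of x] by auto

lemma self_mult_star_eq_0_iff [simp]: "x * star x = 0 \<longleftrightarrow> x = (0::'a::cstar_algebra)"
  using cstar_identity[of "star x"] by auto

lemma selfadjoint_square_eq_0: "star x = x \<Longrightarrow> x * x = 0 \<Longrightarrow> x = (0::'a::cstar_algebra)"
  using star_mult_self_eq_0_iff[of x] by simp

lemma norm_isometry:
  assumes "star u * u = (1::'a::cstar_algebra)"
  shows "norm u = 1"
proof -
  have "(norm u)\<^sup>2 = 1" using cstar_identity[of u] assms by simp
  then show ?thesis by (simp add: power2_eq_1_iff) (metis norm_ge_zero not_one_le_zero neg_0_le_iff_le)
qed

definition real_part :: "'a::cstar_algebra \<Rightarrow> 'a" where
  "real_part x = (1/2) *\<^sub>R (x + star x)"

definition imag_part :: "'a::cstar_algebra \<Rightarrow> 'a" where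
  "imag_part x = (- \<i> / 2) *\<^sub>C (x - star x)"

lemma star_real_part [simp]: "star (real_part x) = real_part x"
  by (simp add: real_part_def add.commute)

lemma star_imag_part [simp]: "star (imag_part x) = imag_part x"
  by (simp add: imag_part_def scaleC_diff_right)

lemma real_plus_imag_part: "real_part x + \<i> *\<^sub>C imag_part x = x"
proof -
  have "real_part x + \<i> *\<^sub>C imag_part x = (1/2) *\<^sub>C (x + star x) + (1/2) *\<^sub>C (x - star x)"
    by (simp add: real_part_def imag_part_def scaleR_scaleC scaleC_scaleC)
  also have "\<dots> = (1/2 + 1/2) *\<^sub>C x"
    unfolding scaleC_add_left scaleC_add_right scaleC_diff_right by simp
  finally show ?thesis by simp
qed

lemma norm_real_part: "norm (real_part x) \<le> norm x"
  using norm_triangle_ineq[of x "star x"] by (simp add: real_part_def)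

lemma norm_imag_part: "norm (imag_part x) \<le> norm x"
  using norm_triangle_ineq4[of x "star x"] by (simp add: imag_part_def norm_scaleC)

lemma star_mult_plus_mult_star:
  "star z * z + z * star z = 2 * (real_part z * real_part z + imag_part z * imag_part z)"
proof -
  define h k where "h = real_part z" and "k = imag_part z"
  have hk: "star h = h" "star k = k" by (simp_all add: h_def k_def)
  have z: "z = h + \<i> *\<^sub>C k" "star z = h - \<i> *\<^sub>C k"
  proof -
    show "z = h + \<i> *\<^sub>C k" by (simp add: real_plus_imag_part h_def k_def)
    then have "star z = star (h + \<i> *\<^sub>C k)" by simp
    then show "star z = h - \<i> *\<^sub>C k" by (simp add: h_def k_def)
  qed
  have "star z * z = h * h + k * k + (\<i> *\<^sub>C (h * k) - \<i> *\<^sub>C (k * h))"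
    "z * star z = h * h + k * k - (\<i> *\<^sub>C (h * k) - \<i> *\<^sub>C (k * h))"
    unfolding z by (simp_all add: hk algebra_simps scaleC_scaleC scaleC_add_right scaleC_diff_right)
  then show ?thesis unfolding h_def[symmetric] k_def[symmetric] by (simp add: mult_2)
qed

lemma unital_cstar_subalgebraD:
  assumes "unital_cstar_subalgebra S"
  shows "cstar_subalgebra S" "1 \<in> S"
  using assms by (auto simp: unital_cstar_subalgebra_def)

lemma cstar_subalgebra_closure:
  assumes S: "cstar_subalgebra S"
  shows "closed S" "0 \<in> S"
    "\<And>x y. x \<in> S \<Longrightarrow> y \<in> S \<Longrightarrow> x + y \<in> S"
    "\<And>x y. x \<in> S \<Longrightarrow> y \<in> S \<Longrightarrow> x - y \<in> S"
    "\<And>x y. x \<in> S \<Longrightarrow> y \<in> S \<Longrightarrow> x * y \<in> S"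
    "\<And>x. x \<in> S \<Longrightarrow> - x \<in> S"
    "\<And>c x. x \<in> S \<Longrightarrow> c *\<^sub>C x \<in> S"
    "\<And>r x. x \<in> S \<Longrightarrow> r *\<^sub>R x \<in> S"
    "\<And>x. x \<in> S \<Longrightarrow> star x \<in> S"
    "\<And>f A. (\<And>i. i \<in> A \<Longrightarrow> f i \<in> S) \<Longrightarrow> sum f A \<in> S"
proof -
  show "closed S" and z: "0 \<in> S" using S by (auto simp: cstar_subalgebra_def)
  show add: "x + y \<in> S" and "x * y \<in> S" if "x \<in> S" "y \<in> S" for x y
    using S that by (auto simp: cstar_subalgebra_def)
  show scal: "c *\<^sub>C x \<in> S" and "star x \<in> S" if "x \<in> S" for c x
    using S that by (auto simp: cstar_subalgebra_def)
  show "r *\<^sub>R x \<in> S" if "x \<in> S" for r x using scal[OF that] by (simp add: scaleR_scaleC)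
  show minus: "- x \<in> S" if "x \<in> S" for x using scal[OF that, of "- 1"] by simp
  show "x - y \<in> S" if "x \<in> S" "y \<in> S" for x y using add[OF that(1) minus[OF that(2)]] by simp
  show "sum f A \<in> S" if "\<And>i. i \<in> A \<Longrightarrow> f i \<in> S" for f :: "'b \<Rightarrow> 'a" and A
    using that by (induction A rule: infinite_finite_induct) (auto intro: z add)
qed

lemmas unital_cstar_subalgebra_closure =
  unital_cstar_subalgebraD(2) cstar_subalgebra_closure[OF unital_cstar_subalgebraD(1)]

section \<open>Square roots\<close>

definition sqrt_coeff :: "nat \<Rightarrow> real" where
  "sqrt_coeff n = ((1/2) gchoose n) * (- 1) ^ n"

lemma sqrt_coeff_0 [simp]: "sqrt_coeff 0 = 1"
  by (simp add: sqrt_coeff_def)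

text \<open>The square of the binomial series with exponent \<open>1/2\<close> is the one with exponent \<open>1\<close>, by
  Vandermonde's identity.\<close>

lemma sqrt_coeff_convolution:
  "(\<Sum>k\<le>n. sqrt_coeff k * sqrt_coeff (n - k)) = (if n = 0 then 1 else if n = 1 then - 1 else 0)"
proof -
  have "(\<Sum>k\<le>n. sqrt_coeff k * sqrt_coeff (n - k)) =
     (\<Sum>k\<le>n. ((1/2) gchoose k) * ((1/2) gchoose (n - k)) * (- 1) ^ n)"
    by (intro sum.cong) (auto simp: sqrt_coeff_def power_add[symmetric])
  also have "\<dots> = (1 gchoose n) * (- 1 :: real) ^ n"
    using gbinomial_Vandermonde[of "1/2 :: real" "1/2" n]
    by (simp add: sum_distrib_right[symmetric] atMost_atLeast0)
  also have "(1 gchoose n :: real) = of_nat (1 choose n)"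
    using binomial_gbinomial[of 1 n, where 'a = real] by simp
  finally show ?thesis by (cases n) (auto simp: binomial_eq_0)
qed

text \<open>All coefficients after the first are negative, so that their absolute values telescope against
  the nonnegative partial sums. This gives absolute convergence on the closed unit ball, including
  its boundary.\<close>

lemma sqrt_coeff_abs_sum: "(\<Sum>k\<le>n. \<bar>sqrt_coeff (Suc k)\<bar>) \<le> 1"
proof -
  \<comment> \<open>The partial sums of the series are, up to sign, the coefficients for the exponent \<open>-1/2\<close>.\<close>
  define d where "d m = (- 1) ^ m * ((- 1/2 :: real) gchoose m)" for m
  have d: "(\<Sum>k\<le>m. sqrt_coeff k) = d m" for m
    unfolding sqrt_coeff_def d_def by (subst gbinomial_sum_lower_neg) simp
  have rec: "d (Suc m) = d m * ((m + 1/2) / (m + 1))" for m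
  proof -
    let ?a = "- 1/2 :: real"
    have "(m + 1) * (?a gchoose Suc m) = (?a - m) * (?a gchoose m)"
      using gbinomial_mult_1[of ?a m] by (simp add: algebra_simps)
    then have g: "(?a gchoose Suc m) = (?a - m) * (?a gchoose m) / (m + 1)"
      by (simp add: field_simps)
    show ?thesis unfolding d_def g by (simp add: field_simps)
  qed
  have nonneg: "d m \<ge> 0" for m
  proof (induction m)
    case (Suc m) then show ?case unfolding rec by (intro mult_nonneg_nonneg) auto
  qed (simp add: d_def)
  have "d m * ((m + 1/2) / (m + 1)) \<le> d m * 1" for m
    by (intro mult_left_mono nonneg) auto
  then have "sqrt_coeff (Suc m) \<le> 0" for m
    using d[of "Suc m"] d[of m] rec[of m] by (metis (no_types) add_le_same_cancel1 mult.right_neutral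
      sum.atMost_Suc)
  then have "(\<Sum>k\<le>n. \<bar>sqrt_coeff (Suc k)\<bar>) = - (\<Sum>k\<le>n. sqrt_coeff (Suc k))"
    by (simp add: sum_negf[symmetric] abs_of_nonpos)
  also have "\<dots> = 1 - d (Suc n)"
    using d[of "Suc n"] by (simp add: sum.atMost_Suc_shift del: sum.atMost_Suc)
  finally show ?thesis using nonneg[of "Suc n"] by simp
qed

lemma summable_sqrt_coeff: "summable (\<lambda>k. \<bar>sqrt_coeff k\<bar>)"
proof -
  have "summable (\<lambda>k. \<bar>sqrt_coeff (Suc k)\<bar>)"
    by (rule bounded_imp_summable[where B = 1]) (use sqrt_coeff_abs_sum in auto)
  then show ?thesis by (subst (asm) summable_Suc_iff)
qed

lemma suminf_sqrt_coeff: "(\<Sum>k. \<bar>sqrt_coeff (Suc k)\<bar>) \<le> 1"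
proof (rule suminf_le_const)
  show "summable (\<lambda>k. \<bar>sqrt_coeff (Suc k)\<bar>)"
    using summable_sqrt_coeff by (subst summable_Suc_iff)
  show "(\<Sum>k<n. \<bar>sqrt_coeff (Suc k)\<bar>) \<le> 1" for n
    using sqrt_coeff_abs_sum[of "n - 1"] by (cases n) (auto simp: lessThan_Suc_atMost)
qed

definition sqrt_one_minus :: "'a::cstar_algebra \<Rightarrow> 'a" where
  "sqrt_one_minus x = (\<Sum>n. sqrt_coeff n *\<^sub>R x ^ n)"

context
  fixes x :: "'a::cstar_algebra"
  assumes x: "norm x \<le> 1"
begin

lemma norm_sqrt_term_le: "norm (sqrt_coeff n *\<^sub>R x ^ n) \<le> \<bar>sqrt_coeff n\<bar>"
proof -
  have "norm (x ^ n) \<le> 1"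
    using norm_power_ineq[of x n] power_le_one[OF norm_ge_zero x, of n] by linarith
  then show ?thesis by (simp add: mult_left_le)
qed

lemma summable_norm_sqrt_term: "summable (\<lambda>n. norm (sqrt_coeff n *\<^sub>R x ^ n))"
  by (rule summable_comparison_test[OF _ summable_sqrt_coeff]) (use norm_sqrt_term_le in auto)

lemma summable_sqrt_term: "summable (\<lambda>n. sqrt_coeff n *\<^sub>R x ^ n)"
  by (rule summable_norm_cancel[OF summable_norm_sqrt_term])

lemma sqrt_one_minus_square: "sqrt_one_minus x * sqrt_one_minus x = 1 - x"
proof -
  let ?f = "\<lambda>k. \<Sum>i\<le>k. (sqrt_coeff i *\<^sub>R x ^ i) * (sqrt_coeff (k - i) *\<^sub>R x ^ (k - i))"
  have f: "?f k = (if k = 0 then 1 else if k = 1 then - x else 0)" for k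
  proof -
    have "?f k = (\<Sum>i\<le>k. (sqrt_coeff i * sqrt_coeff (k - i)) *\<^sub>R x ^ k)"
      by (intro sum.cong) (auto simp: power_add[symmetric] mult.commute)
    also have "\<dots> = (\<Sum>i\<le>k. sqrt_coeff i * sqrt_coeff (k - i)) *\<^sub>R x ^ k"
      by (simp add: scaleR_left.sum)
    finally show ?thesis by (simp add: sqrt_coeff_convolution)
  qed
  have "sqrt_one_minus x * sqrt_one_minus x = (\<Sum>k. ?f k)"
    unfolding sqrt_one_minus_def
    by (rule Cauchy_product[OF summable_norm_sqrt_term summable_norm_sqrt_term])
  also have "\<dots> = (\<Sum>k. if k = 0 then 1 else if k = 1 then - x else 0)"
    by (rule arg_cong[where f = suminf], rule ext, rule f)
  also have "(\<Sum>k. if k = 0 then 1 else if k = 1 then - x else 0) =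
      (\<Sum>k\<in>{0, 1::nat}. if k = 0 then 1 else if k = 1 then - x else 0)"
    by (rule suminf_finite) auto
  finally show ?thesis by simp
qed

text \<open>With \<open>t = 1\<close> in the definition of positivity below, this says that the square root is
  positive when \<open>x\<close> is selfadjoint.\<close>

lemma norm_one_minus_sqrt_one_minus: "norm (1 - sqrt_one_minus x) \<le> 1"
proof -
  have "sqrt_one_minus x = 1 + (\<Sum>n. sqrt_coeff (Suc n) *\<^sub>R x ^ Suc n)"
    unfolding sqrt_one_minus_def using suminf_split_head[OF summable_sqrt_term] by simp
  then have "norm (1 - sqrt_one_minus x) = norm (\<Sum>n. sqrt_coeff (Suc n) *\<^sub>R x ^ Suc n)"
    by (simp add: norm_minus_commute)
  also have "\<dots> \<le> (\<Sum>n. norm (sqrt_coeff (Suc n) *\<^sub>R x ^ Suc n))"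
    using summable_norm_sqrt_term summable_Suc_iff[of "\<lambda>n. norm (sqrt_coeff n *\<^sub>R x ^ n)"]
    by (intro summable_norm) auto
  also have "\<dots> \<le> (\<Sum>n. \<bar>sqrt_coeff (Suc n)\<bar>)"
  proof (rule suminf_le)
    show "norm (sqrt_coeff (Suc n) *\<^sub>R x ^ Suc n) \<le> \<bar>sqrt_coeff (Suc n)\<bar>" for n
      by (rule norm_sqrt_term_le)
    show "summable (\<lambda>n. norm (sqrt_coeff (Suc n) *\<^sub>R x ^ Suc n))"
      using summable_norm_sqrt_term by (subst summable_Suc_iff)
    show "summable (\<lambda>n. \<bar>sqrt_coeff (Suc n)\<bar>)"
      using summable_sqrt_coeff by (subst summable_Suc_iff)
  qed
  also note suminf_sqrt_coeff
  finally show ?thesis .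
qed

lemma star_sqrt_one_minus: "star (sqrt_one_minus x) = sqrt_one_minus (star x)"
  unfolding sqrt_one_minus_def
  using bounded_linear.suminf[OF bounded_linear_star summable_sqrt_term] by simp

lemma sqrt_one_minus_commute:
  assumes "y * x = x * y"
  shows "y * sqrt_one_minus x = sqrt_one_minus x * y"
proof -
  have "y * x ^ n = x ^ n * y" for n
    by (induction n) (simp_all add: assms mult.assoc[symmetric], simp add: assms mult.assoc)
  then show ?thesis
    unfolding sqrt_one_minus_def
    using suminf_mult[OF summable_sqrt_term, of y] suminf_mult2[OF summable_sqrt_term, of y] by simp
qed

lemma sqrt_one_minus_mem:
  assumes S: "unital_cstar_subalgebra S" and "x \<in> S"
  shows "sqrt_one_minus x \<in> S"
proof -
  note closure = unital_cstar_subalgebra_closure[OF S]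
  have "x ^ n \<in> S" for n
    using assms(2) by (induction n) (auto intro: closure)
  then have "(\<Sum>k<n. sqrt_coeff k *\<^sub>R x ^ k) \<in> S" for n
    by (intro closure)
  then show ?thesis
    using summable_LIMSEQ[OF summable_sqrt_term] closure(2)
    unfolding sqrt_one_minus_def
    by (meson closed_sequentially)
qed

end

section \<open>Positive elements\<close>

text \<open>For selfadjoint \<open>a\<close>, the norm condition says that the spectrum lies in \<open>[0, 2t]\<close>. In this form
  sums of positive elements are positive by the triangle inequality, and a square root is given by
  the power series in \<open>1 - a / t\<close>.\<close>

definition psd :: "'a::cstar_algebra \<Rightarrow> bool" where
  "psd a \<longleftrightarrow> star a = a \<and> (\<exists>t>0. norm (t *\<^sub>R 1 - a) \<le> t)"

lemma psd_selfadjoint: "psd a \<Longrightarrow> star a = a"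
  by (simp add: psd_def)

lemma psd_add:
  assumes "psd a" "psd b"
  shows "psd (a + b)"
proof -
  obtain s t where "s > 0" "t > 0" "norm (s *\<^sub>R 1 - a) \<le> s" "norm (t *\<^sub>R 1 - b) \<le> t"
    using assms by (auto simp: psd_def)
  then have "norm ((s + t) *\<^sub>R 1 - (a + b)) \<le> s + t"
    using norm_triangle_ineq[of "s *\<^sub>R 1 - a" "t *\<^sub>R 1 - b"] by (simp add: algebra_simps)
  then show ?thesis using assms \<open>s > 0\<close> \<open>t > 0\<close> unfolding psd_def
    by (metis add_pos_pos star_add)
qed

lemma psd_scaleR:
  assumes "psd a" "r \<ge> 0"
  shows "psd (r *\<^sub>R a)"
proof (cases "r = 0")
  case False
  obtain t where t: "t > 0" "norm (t *\<^sub>R 1 - a) \<le> t" using assms by (auto simp: psd_def)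
  have "norm ((r * t) *\<^sub>R 1 - r *\<^sub>R a) = r * norm (t *\<^sub>R 1 - a)"
    using assms(2) norm_scaleR[of r "t *\<^sub>R 1 - a"] by (simp add: scaleR_diff_right)
  also have "\<dots> \<le> r * t" using t assms(2) by (intro mult_left_mono) auto
  finally show ?thesis using assms False t unfolding psd_def
    by (intro conjI exI[of _ "r * t"]) auto
qed (auto simp: psd_def intro!: exI[of _ 1])

lemma psd_norm_minus:
  assumes "star a = a"
  shows "psd (norm a *\<^sub>R 1 - a)"
  unfolding psd_def
proof (intro conjI exI[of _ "norm a + 1"])
  have "norm ((norm a + 1) *\<^sub>R 1 - (norm a *\<^sub>R 1 - a)) = norm (1 + a)"
    by (simp add: algebra_simps)
  also have "\<dots> \<le> norm a + 1" using norm_triangle_ineq[of 1 a] by simp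
  finally show "norm ((norm a + 1) *\<^sub>R 1 - (norm a *\<^sub>R 1 - a)) \<le> norm a + 1" .
qed (use assms in \<open>auto intro: add_nonneg_pos\<close>)

lemma psd_sqrt:
  fixes a :: "'a::cstar_algebra"
  assumes "psd a"
  obtains h where "psd h" "h * h = a" "\<And>y. y * a = a * y \<Longrightarrow> y * h = h * y"
    "\<And>S. unital_cstar_subalgebra S \<Longrightarrow> a \<in> S \<Longrightarrow> h \<in> S"
proof -
  obtain t where t: "t > 0" "norm (t *\<^sub>R 1 - a) \<le> t" using assms by (auto simp: psd_def)
  define x where "x = 1 - (1 / t) *\<^sub>R a"
  have "x = (1 / t) *\<^sub>R (t *\<^sub>R 1 - a)" using t by (simp add: x_def scaleR_diff_right)
  then have x: "norm x \<le> 1" using t by simp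
  have sax: "star x = x" using psd_selfadjoint[OF assms] by (simp add: x_def)
  define h where "h = sqrt t *\<^sub>R sqrt_one_minus x"
  have "psd (sqrt_one_minus x)"
    unfolding psd_def using norm_one_minus_sqrt_one_minus[OF x] star_sqrt_one_minus[OF x] sax
    by (intro conjI exI[of _ 1]) auto
  then have "psd h" unfolding h_def by (rule psd_scaleR) (use t in simp)
  moreover have "h * h = a"
    using t by (simp add: h_def sqrt_one_minus_square[OF x]) (simp add: x_def)
  moreover have "y * h = h * y" if "y * a = a * y" for y
  proof -
    have "y * x = x * y" using that by (simp add: x_def algebra_simps)
    from sqrt_one_minus_commute[OF x this] show ?thesis by (simp add: h_def)
  qed
  moreover have "h \<in> S" if S: "unital_cstar_subalgebra S" "a \<in> S" for S
  proof -
    note closure = unital_cstar_subalgebra_closure[OF S(1)]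
    have "x \<in> S" unfolding x_def by (intro closure S)
    from sqrt_one_minus_mem[OF x S(1) this] show ?thesis unfolding h_def by (intro closure)
  qed
  ultimately show ?thesis by (rule that)
qed

text \<open>Here \<open>h\<close> is the real part of \<open>u = h + i k\<close>, and \<open>u\<^sup>* u\<close> is the scalar \<open>\<beta>\<close>. This replaces the
  functional calculus in the norm estimates for positive elements.\<close>

lemma norm_le_of_sum_squares:
  fixes h k :: "'a::cstar_algebra"
  assumes "star h = h" "star k = k" "h * k = k * h" and eq: "h * h + k * k = \<beta> *\<^sub>R 1"
  shows "(norm h)\<^sup>2 \<le> \<bar>\<beta>\<bar>"
proof -
  define u where "u = h + \<i> *\<^sub>C k"
  have "star u * u = h * h + k * k"
    using assms by (simp add: u_def algebra_simps scaleC_scaleC scaleC_add_right scaleC_diff_right)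
  then have "(norm u)\<^sup>2 = \<bar>\<beta>\<bar>" using cstar_identity[of u] eq by simp
  moreover have "h = real_part u"
    using assms by (simp add: u_def real_part_def)
  then have "norm h \<le> norm u" using norm_real_part[of u] by simp
  ultimately show ?thesis using power_mono[of "norm h" "norm u" 2] by simp
qed

text \<open>With \<open>s = sqrt (1 - h\<^sup>2)\<close> the element \<open>h + i s\<close> is unitary.\<close>

lemma selfadjoint_unitary:
  fixes h :: "'a::cstar_algebra"
  assumes h: "star h = h" "norm h \<le> 1"
  obtains s where "star s = s" "h * s = s * h" "h * h + s * s = 1"
    "\<And>S. unital_cstar_subalgebra S \<Longrightarrow> h \<in> S \<Longrightarrow> s \<in> S"
proof -
  have n: "norm (h * h) \<le> 1"
    using norm_mult_ineq[of h h] mult_le_one[OF h(2) norm_ge_zero h(2)] by linarith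
  let ?s = "sqrt_one_minus (h * h)"
  have "star ?s = ?s" using star_sqrt_one_minus[OF n] h by simp
  moreover have "h * ?s = ?s * h" by (rule sqrt_one_minus_commute[OF n]) (simp add: mult.assoc)
  moreover have "h * h + ?s * ?s = 1" by (simp add: sqrt_one_minus_square[OF n])
  moreover have "?s \<in> S" if "unital_cstar_subalgebra S" "h \<in> S" for S
    by (rule sqrt_one_minus_mem[OF n that(1)])
      (intro unital_cstar_subalgebra_closure that)
  ultimately show ?thesis by (rule that)
qed

lemma psd_square:
  fixes h :: "'a::cstar_algebra"
  assumes "star h = h"
  shows "psd (h * h)"
proof (cases "h = 0")
  case False
  define g where "g = (1 / norm h) *\<^sub>R h"
  have g: "star g = g" "norm g \<le> 1" using assms False by (auto simp: g_def)
  obtain s where s: "star s = s" "g * s = s * g" "g * g + s * s = 1"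
    using selfadjoint_unitary[OF g] by metis
  have "(norm s)\<^sup>2 \<le> 1"
    using norm_le_of_sum_squares[of s g 1] g s by (simp add: add.commute)
  then have "norm (s * s) \<le> 1" using norm_mult_ineq[of s s] by (simp add: power2_eq_square)
  moreover have "1 - g * g = s * s" using s(3) by (simp add: algebra_simps)
  ultimately have "psd (g * g)" unfolding psd_def using g by (intro conjI exI[of _ 1]) auto
  then have "psd ((norm h)\<^sup>2 *\<^sub>R (g * g))" by (rule psd_scaleR) simp
  moreover have "(norm h)\<^sup>2 *\<^sub>R (g * g) = h * h"
    using False by (simp add: g_def power2_eq_square)
  ultimately show ?thesis by simp
qed (auto simp: psd_def intro!: exI[of _ 1])

lemma norm_le_of_psd:
  fixes a :: "'a::cstar_algebra"
  assumes "psd a" "psd (\<beta> *\<^sub>R 1 - a)" "\<beta> \<ge> 0"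
  shows "norm a \<le> \<beta>"
proof -
  obtain h where h: "psd h" "h * h = a" using psd_sqrt[OF assms(1)] by metis
  obtain k where k: "psd k" "k * k = \<beta> *\<^sub>R 1 - a"
    "\<And>y. y * (\<beta> *\<^sub>R 1 - a) = (\<beta> *\<^sub>R 1 - a) * y \<Longrightarrow> y * k = k * y"
    using psd_sqrt[OF assms(2)] by metis
  have "h * k = k * h"
    by (rule k(3)) (simp add: h(2)[symmetric] algebra_simps)
  then have "(norm h)\<^sup>2 \<le> \<bar>\<beta>\<bar>"
    by (intro norm_le_of_sum_squares[of h k] psd_selfadjoint h(1) k(1)) (auto simp: h(2) k(2))
  moreover have "norm a \<le> (norm h)\<^sup>2"
    using norm_mult_ineq[of h h] h by (simp add: power2_eq_square)
  ultimately show ?thesis using assms(3) by simp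
qed

lemma psd_antisym:
  assumes "psd a" "psd (- a)"
  shows "a = 0"
  using norm_le_of_psd[of a 0] assms by simp

lemma norm_mono_psd:
  assumes "psd a" "psd (b - a)"
  shows "norm a \<le> norm b"
proof (rule norm_le_of_psd[OF assms(1)])
  have "star b = b" using psd_selfadjoint[OF psd_add[OF assms]] by simp
  from psd_add[OF assms(2) psd_norm_minus[OF this]]
  show "psd (norm b *\<^sub>R 1 - a)" by (simp add: algebra_simps)
qed simp

lemma psd_add_eq_0:
  assumes "psd a" "psd b" "a + b = 0"
  shows "a = 0"
proof (rule psd_antisym[OF assms(1)])
  have "b = - a" using assms(3) by (simp add: eq_neg_iff_add_eq_0 add.commute)
  then show "psd (- a)" using assms(2) by simp
qed

text \<open>The sum \<open>w\<^sup>* w + w w\<^sup>*\<close> is positive for every \<open>w\<close>, being twice a sum of two squares of selfadjoint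
  elements. For \<open>w = z s\<close> both summands are negative squares, so both vanish; for \<open>w = z\<close> itself
  this would be known of the first summand only.\<close>

lemma negative_star_mult_self:
  fixes z s :: "'a::cstar_algebra"
  assumes s: "star s = s" and zz: "star z * z = - (s * s)"
  shows "z = 0"
proof -
  define w where "w = z * s"
  define p where "p = z * star z"
  have 1: "star w * w = - ((s * s) * (s * s))"
  proof -
    have "star w * w = s * (star z * z) * s" using s by (simp add: w_def mult.assoc)
    then show ?thesis unfolding zz by (simp add: mult.assoc)
  qed
  have 2: "w * star w = - (p * p)"
  proof -
    have "w * star w = - (z * (- (s * s)) * star z)" using s by (simp add: w_def mult.assoc)
    then show ?thesis unfolding zz[symmetric] by (simp add: p_def mult.assoc)
  qed
  have "psd (star w * w + w * star w)"
    unfolding star_mult_plus_mult_star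
    using psd_scaleR[OF psd_add[OF psd_square psd_square], of "real_part w" "imag_part w" 2]
    by (simp add: scaleR_2 mult_2 algebra_simps)
  moreover have "psd (p * p)" "psd ((s * s) * (s * s))"
    by (rule psd_square; simp add: p_def s)+
  ultimately have "p * p + (s * s) * (s * s) = 0"
    unfolding 1 2 by (intro psd_antisym psd_add) (simp_all add: algebra_simps)
  then have "p * p = 0" by (rule psd_add_eq_0[rotated 2]) fact+
  then have "p = 0" by (rule selfadjoint_square_eq_0[rotated]) (simp_all add: p_def)
  then show ?thesis by (simp add: p_def)
qed

text \<open>Let \<open>b = \<bar>a\<bar> - a\<close> be twice the negative part of \<open>a = y\<^sup>* y\<close>. Then \<open>z = y b\<close> has negative \<open>z\<^sup>* z = b a b\<close>,
  hence vanishes, and this forces \<open>b = 0\<close>.\<close>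

theorem psd_star_mult_self: "psd (star y * (y::'a::cstar_algebra))"
proof -
  define a where "a = star y * y"
  have a: "star a = a" by (simp add: a_def)
  \<comment> \<open>\<open>m\<close> is the absolute value of \<open>a\<close>.\<close>
  obtain m where m: "psd m" "m * m = a * a" "\<And>x. x * (a * a) = (a * a) * x \<Longrightarrow> x * m = m * x"
    using psd_sqrt[OF psd_square[OF a]] by metis
  obtain q where q: "psd q" "q * q = m" "\<And>x. x * m = m * x \<Longrightarrow> x * q = q * x"
    using psd_sqrt[OF m(1)] by metis
  have am: "a * m = m * a" by (rule m(3)) (simp add: mult.assoc)
  have aq: "a * q = q * a" by (rule q(3)[OF am])
  define b where "b = m - a"
  have sa: "star m = m" "star q = q" by (rule psd_selfadjoint[OF m(1)], rule psd_selfadjoint[OF q(1)])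
  have b: "star b = b" using sa a by (simp add: b_def)
  have ab: "a * b = - (m * b)" by (simp add: b_def algebra_simps m(2) am)
  have bq: "b * q = q * b" by (simp add: b_def algebra_simps aq q(2)[symmetric])
  have "star (y * b) * (y * b) = b * (a * b)" by (simp add: a_def b mult.assoc)
  also have "\<dots> = - (b * (q * q) * b)" unfolding ab q(2) by (simp add: mult.assoc)
  also have "\<dots> = - ((q * b) * (q * b))" using bq by (metis mult.assoc)
  finally have "y * b = 0"
    by (rule negative_star_mult_self[rotated]) (simp add: sa b bq)
  then have "a * b = 0" by (simp add: a_def mult.assoc)
  then have "b * b = 0" using ab by (simp add: b_def left_diff_distrib)
  then have "b = 0" by (rule selfadjoint_square_eq_0[OF b])
  then show ?thesis using m(1) by (simp add: b_def a_def)
qed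

lemma psd_conjugate:
  assumes "psd a"
  shows "psd (star y * a * y)"
proof -
  obtain h where h: "psd h" "h * h = a" using psd_sqrt[OF assms] by metis
  have "star y * a * y = star (h * y) * (h * y)"
    unfolding h(2)[symmetric] using psd_selfadjoint[OF h(1)] by (simp add: mult.assoc)
  then show ?thesis using psd_star_mult_self by metis
qed

lemma psd_of_real_iff: "psd (r *\<^sub>R (1::'a::cstar_algebra)) \<longleftrightarrow> r \<ge> 0"
proof
  show "psd (r *\<^sub>R (1::'a))" if "r \<ge> 0"
    using psd_scaleR[of 1 r] psd_star_mult_self[of "1::'a"] that by simp
  show "r \<ge> 0" if r: "psd (r *\<^sub>R (1::'a))"
  proof (rule ccontr)
    assume "\<not> r \<ge> 0"
    then have "psd ((- r) *\<^sub>R (1::'a))"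
      using psd_scaleR[of 1 "- r"] psd_star_mult_self[of "1::'a"] by simp
    then have "r *\<^sub>R (1::'a) = 0" using psd_antisym[OF r] by simp
    with \<open>\<not> r \<ge> 0\<close> show False by simp
  qed
qed

section \<open>Unitaries span, and *-homomorphisms are bounded\<close>

lemma unitary_decomposition:
  assumes S: "unital_cstar_subalgebra S" and h: "h \<in> S" "star h = h" "norm h \<le> 1"
  obtains u where "u \<in> unitaries S" "h = (1/2) *\<^sub>R (u + star u)"
proof -
  obtain s where s: "star s = s" "h * s = s * h" "h * h + s * s = 1"
    "\<And>S. unital_cstar_subalgebra S \<Longrightarrow> h \<in> S \<Longrightarrow> s \<in> S"
    using selfadjoint_unitary[OF h(2,3)] by metis
  define u where "u = h + \<i> *\<^sub>C s"
  have "u \<in> S" unfolding u_def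
    by (intro unital_cstar_subalgebra_closure[OF S] h(1) s(4)[OF S h(1)])
  moreover have "star u * u = 1" "u * star u = 1"
    using s(1-3) h(2)
    by (simp_all add: u_def algebra_simps scaleC_scaleC scaleC_add_right scaleC_diff_right)
  moreover have "h = (1/2) *\<^sub>R (u + star u)"
    using s(1) h(2) by (simp add: u_def)
  ultimately show ?thesis using that by (auto simp: unitaries_def)
qed

text \<open>Every element is a linear combination of two selfadjoint contractions, and each of these is a
  mean of two unitaries.\<close>

lemma subset_of_unitaries_subset:
  assumes S: "unital_cstar_subalgebra S" and T: "cstar_subalgebra T" and "unitaries S \<subseteq> T"
  shows "S \<subseteq> T"
proof
  have sa: "h \<in> T" if h: "h \<in> S" "star h = h" for h
  proof (cases "h = 0")
    case True then show ?thesis using cstar_subalgebra_closure(2)[OF T] by simp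
  next
    case False
    define g where "g = (1 / norm h) *\<^sub>R h"
    have g: "star g = g" "norm g \<le> 1" using h False by (auto simp: g_def)
    have "g \<in> S" unfolding g_def by (intro unital_cstar_subalgebra_closure[OF S] h)
    from unitary_decomposition[OF S this g] obtain u
      where u: "u \<in> unitaries S" "g = (1/2) *\<^sub>R (u + star u)" by metis
    have "g \<in> T" unfolding u(2)
      by (intro cstar_subalgebra_closure[OF T]) (use u(1) assms(3) in auto)
    then have "norm h *\<^sub>R g \<in> T" by (intro cstar_subalgebra_closure[OF T])
    then show ?thesis using False by (simp add: g_def)
  qed
  fix x assume x: "x \<in> S"
  have "real_part x \<in> S" "imag_part x \<in> S"
    unfolding real_part_def imag_part_def by (intro unital_cstar_subalgebra_closure[OF S] x)+
  then have "real_part x \<in> T" "imag_part x \<in> T" using sa by auto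
  then have "real_part x + \<i> *\<^sub>C imag_part x \<in> T" by (intro cstar_subalgebra_closure[OF T])
  then show "x \<in> T" by (simp add: real_plus_imag_part)
qed

text \<open>A *-homomorphism maps unitaries to unitaries, hence selfadjoint contractions \<open>(u + u\<^sup>*) / 2\<close>
  to contractions.\<close>

lemma star_hom_bounded:
  fixes f :: "'a::cstar_algebra \<Rightarrow> 'b::cstar_algebra"
  assumes S: "unital_cstar_subalgebra S"
    and add: "\<And>x y. x \<in> S \<Longrightarrow> y \<in> S \<Longrightarrow> f (x + y) = f x + f y"
    and scal: "\<And>c x. x \<in> S \<Longrightarrow> f (c *\<^sub>C x) = c *\<^sub>C f x"
    and mult: "\<And>x y. x \<in> S \<Longrightarrow> y \<in> S \<Longrightarrow> f (x * y) = f x * f y"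
    and star: "\<And>x. x \<in> S \<Longrightarrow> f (star x) = star (f x)"
    and one: "f 1 = 1" and "x \<in> S"
  shows "norm (f x) \<le> norm x"
proof (cases "x = 0")
  case True
  then show ?thesis using scal[OF \<open>x \<in> S\<close>, of 0] by simp
next
  case False
  note closure = unital_cstar_subalgebra_closure[OF S]
  \<comment> \<open>By the C*-identity it suffices to bound the image of the selfadjoint contraction \<open>x\<^sup>* x / \<parallel>x\<parallel>\<^sup>2\<close>.\<close>
  define h where "h = (1 / (norm x)\<^sup>2) *\<^sub>R (star x * x)"
  have h: "star h = h" "norm h \<le> 1" by (auto simp: h_def cstar_identity)
  have hS: "h \<in> S" unfolding h_def by (intro closure \<open>x \<in> S\<close>)
  from unitary_decomposition[OF S hS h] obtain u
    where u: "u \<in> unitaries S" "h = (1/2) *\<^sub>R (u + star u)" by metis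
  have uS: "u \<in> S" "star u \<in> S" using u by (auto simp: unitaries_def intro: closure)
  have "norm (f u) = 1"
    by (rule norm_isometry) (use u uS star[of u] mult[of "star u" u] one in \<open>auto simp: unitaries_def\<close>)
  moreover have "f h = (1/2) *\<^sub>R (f u + star (f u))"
    unfolding u(2) using scal[OF closure(4)[OF uS]] add[OF uS] star[OF uS(1)]
    by (simp add: scaleR_scaleC)
  ultimately have "norm (f h) \<le> 1" using norm_triangle_ineq[of "f u" "star (f u)"] by simp
  moreover have "f h = (1 / (norm x)\<^sup>2) *\<^sub>R (star (f x) * f x)"
    using \<open>x \<in> S\<close> by (simp add: h_def scaleR_scaleC scal mult star closure)
  ultimately have "(norm (f x))\<^sup>2 \<le> (norm x)\<^sup>2"
    using False by (simp add: cstar_identity)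
  then show ?thesis by (rule power2_le_imp_le) simp
qed

section \<open>Simple algebras have trivial centre\<close>

text \<open>The annihilator of a central element is a closed ideal.\<close>

lemma simple_no_zero_divisor:
  assumes B: "unital_cstar_subalgebra B" and "simple_cstar B"
    and z: "\<And>b. b \<in> B \<Longrightarrow> z * b = b * z" and "w \<in> B" "z * w = 0"
  shows "z = 0 \<or> w = 0"
proof -
  note closure = unital_cstar_subalgebra_closure[OF B]
  define J where "J = {b \<in> B. z * b = 0}"
  have "J = B \<inter> (\<lambda>b. z * b) -` {0}" by (auto simp: J_def)
  moreover have "closed ((\<lambda>b. z * b) -` {0})"
    by (intro continuous_closed_vimage) (auto intro!: continuous_intros)
  ultimately have "closed J" using closure(2) by auto
  moreover have "z * (s * x) = 0" if "s \<in> B" "z * x = 0" for s x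
  proof -
    have "z * (s * x) = s * (z * x)" using z[OF that(1)] by (simp add: mult.assoc[symmetric])
    then show ?thesis using that by simp
  qed
  ultimately have "closed_ideal B J"
    unfolding closed_ideal_def J_def
    by (auto intro: closure simp: distrib_left mult.assoc[symmetric])
  then consider "J = {0}" | "J = B" using \<open>simple_cstar B\<close> by (auto simp: simple_cstar_def)
  then show ?thesis
  proof cases
    case 1 then show ?thesis using assms(4,5) by (auto simp: J_def)
  next
    case 2
    then have "1 \<in> J" using closure(1) by simp
    then show ?thesis by (simp add: J_def)
  qed
qed

text \<open>With \<open>m = \<bar>k\<bar>\<close>, which is again central, \<open>(m - k)(m + k) = 0\<close>, and one factor vanishes.\<close>

lemma central_selfadjoint_signed:
  assumes B: "unital_cstar_subalgebra B" and simple: "simple_cstar B"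
    and k: "k \<in> B" "star k = k" "\<And>b. b \<in> B \<Longrightarrow> k * b = b * k"
  shows "psd k \<or> psd (- k)"
proof -
  note closure = unital_cstar_subalgebra_closure[OF B]
  obtain m where m: "psd m" "m * m = k * k" "\<And>y. y * (k * k) = (k * k) * y \<Longrightarrow> y * m = m * y"
    "\<And>S. unital_cstar_subalgebra S \<Longrightarrow> k * k \<in> S \<Longrightarrow> m \<in> S"
    using psd_sqrt[OF psd_square[OF k(2)]] by metis
  have mB: "m \<in> B" by (intro m(4) B closure k)
  have mz: "m * b = b * m" if "b \<in> B" for b
  proof -
    have "b * (k * k) = (k * k) * b" using k(3)[OF that] by (metis mult.assoc)
    then show ?thesis using m(3) by simp
  qed
  have "(m - k) * (m + k) = 0"
    using m(2) mz[OF k(1)] by (simp add: algebra_simps)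
  moreover have "m + k \<in> B" by (intro closure mB k)
  moreover have "(m - k) * b = b * (m - k)" if "b \<in> B" for b
    using mz[OF that] k(3)[OF that] by (simp add: algebra_simps)
  ultimately consider "m - k = 0" | "m + k = 0"
    using simple_no_zero_divisor[OF B simple, of "m - k" "m + k"] by blast
  then show ?thesis using m(1) by cases (auto simp: add_eq_0_iff)
qed

text \<open>The translates \<open>h - t\<close> are positive or negative, so that \<open>h\<close> is squeezed onto the supremum of the
  \<open>t\<close> for which \<open>h - t\<close> is positive.\<close>

lemma central_selfadjoint_scalar:
  assumes B: "unital_cstar_subalgebra B" and simple: "simple_cstar B"
    and h: "h \<in> B" "star h = h" "\<And>b. b \<in> B \<Longrightarrow> h * b = b * h"
  shows "\<exists>r. h = r *\<^sub>R 1"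
proof -
  note closure = unital_cstar_subalgebra_closure[OF B]
  define T where "T = {t. psd (h - t *\<^sub>R 1)}"
  have "- norm h \<in> T"
    using psd_norm_minus[of "- h"] h(2) by (simp add: T_def algebra_simps)
  then have ne: "T \<noteq> {}" by blast
  have bdd: "bdd_above T"
  proof (rule bdd_aboveI[where M = "norm h"])
    fix t assume "t \<in> T"
    then have "psd ((h - t *\<^sub>R 1) + (norm h *\<^sub>R 1 - h))"
      unfolding T_def by (intro psd_add psd_norm_minus h(2)) simp
    then have "psd ((norm h - t) *\<^sub>R (1::'a))" by (simp add: algebra_simps)
    then show "t \<le> norm h" by (simp add: psd_of_real_iff)
  qed
  have "norm (h - Sup T *\<^sub>R 1) \<le> 0 + \<epsilon>" if "\<epsilon> > 0" for \<epsilon>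
  proof -
    define e where "e = \<epsilon> / 3"
    have e: "e > 0" using that by (simp add: e_def)
    obtain t where t: "t \<in> T" "Sup T - e < t"
      using less_cSupD[OF ne, of "Sup T - e"] e by auto
    have "t \<le> Sup T" by (rule cSup_upper[OF t(1) bdd])
    define s where "s = Sup T + e"
    have "s \<notin> T" using cSup_upper[OF _ bdd, of s] e by (auto simp: s_def)
    moreover have "psd (h - s *\<^sub>R 1) \<or> psd (- (h - s *\<^sub>R 1))"
    proof (rule central_selfadjoint_signed[OF B simple])
      show "h - s *\<^sub>R 1 \<in> B" by (intro closure h(1))
    qed (simp_all add: h(2,3) algebra_simps)
    ultimately have "psd ((s - t) *\<^sub>R 1 - (h - t *\<^sub>R 1))" by (simp add: T_def algebra_simps)
    moreover have "s - t \<ge> 0" using \<open>t \<le> Sup T\<close> e by (simp add: s_def)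
    ultimately have "norm (h - t *\<^sub>R 1) \<le> s - t"
      using t(1) unfolding T_def by (intro norm_le_of_psd) simp_all
    moreover have "norm ((h - t *\<^sub>R 1) + (t - Sup T) *\<^sub>R 1) \<le> norm (h - t *\<^sub>R 1) + \<bar>t - Sup T\<bar>"
      using norm_triangle_ineq[of "h - t *\<^sub>R 1" "(t - Sup T) *\<^sub>R (1::'a)"] by simp
    ultimately show ?thesis using t \<open>t \<le> Sup T\<close>
      by (simp add: algebra_simps s_def e_def)
  qed
  then have "norm (h - Sup T *\<^sub>R 1) \<le> 0" by (rule field_le_epsilon)
  then show ?thesis by auto
qed

lemma central_scalar:
  assumes B: "unital_cstar_subalgebra B" and simple: "simple_cstar B"
    and z: "z \<in> B" "\<And>b. b \<in> B \<Longrightarrow> z * b = b * z"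
  shows "\<exists>c. z = c *\<^sub>C 1"
proof -
  note closure = unital_cstar_subalgebra_closure[OF B]
  have zs: "star z * b = b * star z" if "b \<in> B" for b
    using arg_cong[OF z(2)[OF closure(10)[OF that]], of star] by simp
  have "\<exists>r. real_part z = r *\<^sub>R 1"
  proof (rule central_selfadjoint_scalar[OF B simple])
    show "real_part z \<in> B" unfolding real_part_def by (intro closure z)
  qed (simp_all add: z zs real_part_def algebra_simps)
  moreover have "\<exists>r. imag_part z = r *\<^sub>R 1"
  proof (rule central_selfadjoint_scalar[OF B simple])
    show "imag_part z \<in> B" unfolding imag_part_def by (intro closure z)
  qed (simp_all add: z zs imag_part_def algebra_simps scaleC_diff_right)
  ultimately obtain r s where "real_part z = r *\<^sub>R 1" "imag_part z = s *\<^sub>R 1" by blast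
  then have "z = (complex_of_real r + \<i> * complex_of_real s) *\<^sub>C 1"
    using real_plus_imag_part[of z] by (simp add: scaleR_scaleC scaleC_scaleC scaleC_add_left)
  then show ?thesis by blast
qed

lemma psd_scalar:
  assumes "psd (c *\<^sub>C (1::'a::cstar_algebra))"
  shows "\<exists>r\<ge>0. c = complex_of_real r"
proof -
  have "cnj c *\<^sub>C (1::'a) = c *\<^sub>C 1" using psd_selfadjoint[OF assms] by simp
  then have "(cnj c - c) *\<^sub>C (1::'a) = 0"
    using scaleC_add_left[of "cnj c" "- c" "1::'a"] by simp
  then have "cnj c = c" by simp
  then have c: "c = complex_of_real (Re c)" by (simp add: complex_eq_iff)
  then have "psd (Re c *\<^sub>R (1::'a))" using assms by (simp add: scaleR_scaleC)
  then show ?thesis using c psd_of_real_iff by blast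
qed

text \<open>Both \<open>t\<^sup>* t\<close> and \<open>t t\<^sup>*\<close> commute with \<open>B\<close>, so they are scalars, and \<open>t (t\<^sup>* t) = (t t\<^sup>*) t\<close> shows that the
  scalars agree. Hence \<open>t\<close> is a multiple of a unitary.\<close>

lemma intertwiner_inner:
  assumes B: "unital_cstar_subalgebra B" and simple: "simple_cstar B"
    and t: "t \<in> B" "t \<noteq> 0"
    and \<theta>: "\<theta> ` B = B" "\<And>b. b \<in> B \<Longrightarrow> \<theta> (star b) = star (\<theta> b)"
    and tb: "\<And>b. b \<in> B \<Longrightarrow> t * b = \<theta> b * t"
  shows "\<exists>w\<in>unitaries B. \<forall>b\<in>B. \<theta> b = w * b * star w"
proof -
  note closure = unital_cstar_subalgebra_closure[OF B]
  have bt: "b * star t = star t * \<theta> b" if "b \<in> B" for b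
  proof -
    have "star (t * star b) = star (\<theta> (star b) * t)" by (simp only: tb[OF closure(10)[OF that]])
    then show ?thesis using \<theta>(2)[OF that] by simp
  qed
  have "(star t * t) * b = b * (star t * t)" if "b \<in> B" for b
    using tb[OF that] bt[OF that] by (metis mult.assoc)
  then obtain c where c: "star t * t = c *\<^sub>C 1"
    using central_scalar[OF B simple, of "star t * t"] closure(6,10) t by blast
  have "(t * star t) * b = b * (t * star t)" if "b \<in> B" for b
  proof -
    have "b \<in> \<theta> ` B" unfolding \<theta>(1) by (rule that)
    then obtain b' where b': "b' \<in> B" "b = \<theta> b'" by (elim imageE) simp
    have "(t * star t) * b = t * (b' * star t)" by (simp add: bt[OF b'(1)] b'(2) mult.assoc)
    also have "\<dots> = b * (t * star t)" by (simp add: tb[OF b'(1)] b'(2) mult.assoc[symmetric])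
    finally show ?thesis .
  qed
  then obtain d where d: "t * star t = d *\<^sub>C 1"
    using central_scalar[OF B simple, of "t * star t"] closure(6,10) t by blast
  have "c *\<^sub>C t = t * (star t * t)" by (simp add: c)
  also have "\<dots> = d *\<^sub>C t" by (simp add: mult.assoc[symmetric] d)
  finally have "(c - d) *\<^sub>C t = 0" using scaleC_add_left[of c "- d" t] by simp
  then have "c = d" using t by simp
  obtain r where r: "r \<ge> 0" "c = complex_of_real r"
    using psd_scalar[of c] psd_star_mult_self[of t] unfolding c by blast
  have "r \<noteq> 0" using t c r by auto
  define w where "w = (1 / sqrt r) *\<^sub>R t"
  have rr: "1 / sqrt r * (1 / sqrt r) = 1 / r" using r by simp
  have "star w * w = (1 / r) *\<^sub>R (star t * t)" "w * star w = (1 / r) *\<^sub>R (t * star t)"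
    by (simp_all add: w_def rr[symmetric])
  then have ww: "star w * w = 1" "w * star w = 1"
    using \<open>r \<noteq> 0\<close> r unfolding c d \<open>c = d\<close>[symmetric] by (simp_all add: scaleR_scaleC scaleC_scaleC)
  have "w \<in> B" unfolding w_def by (intro closure t(1))
  then have "w \<in> unitaries B" using ww by (simp add: unitaries_def)
  moreover have "\<theta> b = w * b * star w" if "b \<in> B" for b
  proof -
    have "w * b = \<theta> b * w" using tb[OF that] by (simp add: w_def)
    then show ?thesis using ww by (simp add: mult.assoc)
  qed
  ultimately show ?thesis by blast
qed

section \<open>Expectations of finite index\<close>

locale finite_index_expectation =
  fixes B :: "'a::cstar_algebra set" and E :: "'a \<Rightarrow> 'a" and n :: nat and l :: "nat \<Rightarrow> 'a"
  assumes subalgebra: "unital_cstar_subalgebra B"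
    and expectation: "conditional_expectation B E"
    and quasi_basis: "x = (\<Sum>i<n. E (x * l i) * star (l i))"
begin

lemmas B_closure = unital_cstar_subalgebra_closure[OF subalgebra]

lemma E_mem: "E x \<in> B"
  and E_id: "b \<in> B \<Longrightarrow> E b = b"
  and E_add: "E (x + y) = E x + E y"
  and E_scaleC: "E (c *\<^sub>C x) = c *\<^sub>C E x"
  and E_positive: "\<exists>y\<in>B. E (star x * x) = star y * y"
  using expectation by (auto simp: conditional_expectation_def positive_in_def)

lemma E_left: "b \<in> B \<Longrightarrow> E (b * x) = b * E x"
  and E_right: "b \<in> B \<Longrightarrow> E (x * b) = E x * b"
proof -
  have *: "E (b * x * b') = b * E x * b'" if "b \<in> B" "b' \<in> B" for b b'
    using expectation that by (auto simp: conditional_expectation_def)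
  show "b \<in> B \<Longrightarrow> E (b * x) = b * E x" using *[OF _ B_closure(1)] by simp
  show "b \<in> B \<Longrightarrow> E (x * b) = E x * b" using *[OF B_closure(1)] by simp
qed

lemma E_zero [simp]: "E 0 = 0"
  using E_scaleC[of 0 0] by simp

lemma E_minus: "E (- x) = - E x"
  using E_scaleC[of "- 1" x] by simp

lemma E_diff: "E (x - y) = E x - E y"
  using E_add[of x "- y"] by (simp add: E_minus)

lemma E_scaleR: "E (r *\<^sub>R x) = r *\<^sub>R E x"
  by (simp add: scaleR_scaleC E_scaleC)

lemma E_sum: "E (sum f A) = (\<Sum>i\<in>A. E (f i))"
  by (induction A rule: infinite_finite_induct) (simp_all add: E_add)

lemma psd_E: "psd a \<Longrightarrow> psd (E a)"
proof -
  assume "psd a"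
  then obtain h where h: "psd h" "h * h = a" using psd_sqrt by metis
  have "a = star h * h" using h psd_selfadjoint[of h] by simp
  then show "psd (E a)" using E_positive[of h] psd_star_mult_self by metis
qed

lemma psd_E_star_mult_self: "psd (E (star x * x))"
  by (rule psd_E[OF psd_star_mult_self])

lemma E_star: "E (star x) = star (E x)"
proof -
  have sa: "star (E h) = E h" if "star h = h" for h
  proof -
    have "h = (1/4) *\<^sub>R ((h + 1) * (h + 1)) - (1/4) *\<^sub>R ((h - 1) * (h - 1))"
    proof -
      have "(h + 1) * (h + 1) - (h - 1) * (h - 1) = 4 *\<^sub>R h"
        using scaleR_left_distrib[of 2 2 h] by (simp add: algebra_simps scaleR_2)
      then have "(1/4) *\<^sub>R ((h + 1) * (h + 1) - (h - 1) * (h - 1)) = h" by simp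
      then show ?thesis by (simp only: scaleR_diff_right)
    qed
    then have "E h = (1/4) *\<^sub>R E ((h + 1) * (h + 1)) - (1/4) *\<^sub>R E ((h - 1) * (h - 1))"
      by (metis E_diff E_scaleR)
    moreover have "star (E (k * k)) = E (k * k)" if "star k = k" for k
      by (intro psd_selfadjoint psd_E psd_square that)
    ultimately show ?thesis using that by simp
  qed
  have x: "x = real_part x + \<i> *\<^sub>C imag_part x" by (simp add: real_plus_imag_part)
  have "star x = real_part x - \<i> *\<^sub>C imag_part x" by (subst x) simp
  then have "E (star x) = E (real_part x) - \<i> *\<^sub>C E (imag_part x)" by (simp add: E_diff E_scaleC)
  moreover have "E x = E (real_part x) + \<i> *\<^sub>C E (imag_part x)"
    by (subst x) (simp only: E_add E_scaleC)
  ultimately show ?thesis by (simp add: sa)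
qed

text \<open>For selfadjoint \<open>h\<close>, positivity of \<open>\<parallel>h\<parallel> \<plusminus> E(h)\<close> gives the factor \<open>3\<close>, which doubles when real and
  imaginary parts are added.\<close>

lemma norm_E_le: "norm (E x) \<le> 6 * norm x"
proof -
  have sa: "norm (E h) \<le> 3 * norm h" if h: "star h = h" for h
  proof -
    have 1: "psd (norm h *\<^sub>R 1 - E h)" "psd (norm h *\<^sub>R 1 + E h)"
      using psd_E[OF psd_norm_minus[OF h]] psd_E[OF psd_norm_minus[of "- h"]] h E_id[OF B_closure(1)]
      by (simp_all add: E_diff E_add E_scaleR)
    have "norm (norm h *\<^sub>R 1 + E h) \<le> 2 * norm h"
    proof (rule norm_le_of_psd)
      have "(2 * norm h) *\<^sub>R 1 - (norm h *\<^sub>R 1 + E h) = norm h *\<^sub>R 1 - E h"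
        using scaleR_left_distrib[of "norm h" "norm h" "1::'a"] by simp
      then show "psd ((2 * norm h) *\<^sub>R 1 - (norm h *\<^sub>R 1 + E h))" using 1(1) by (simp only:)
    qed (use 1 in auto)
    then show ?thesis
      using norm_triangle_ineq4[of "norm h *\<^sub>R 1 + E h" "norm h *\<^sub>R 1"] by simp
  qed
  have "E x = E (real_part x) + \<i> *\<^sub>C E (imag_part x)"
    using real_plus_imag_part[of x] by (metis E_add E_scaleC)
  then have "norm (E x) \<le> norm (E (real_part x)) + norm (E (imag_part x))"
    using norm_triangle_ineq[of "E (real_part x)" "\<i> *\<^sub>C E (imag_part x)"] by (simp add: norm_scaleC)
  then show ?thesis
    using sa[of "real_part x"] sa[of "imag_part x"] norm_real_part[of x] norm_imag_part[of x] by simp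
qed

lemma bounded_linear_E: "bounded_linear E"
  by (rule bounded_linear_intro[where K = 6])
    (use norm_E_le in \<open>simp_all add: E_add E_scaleR mult.commute\<close>)

text \<open>As for scalar products, the inequality expresses positivity of \<open>E(w\<^sup>* w)\<close> for \<open>w = L x - y E(y\<^sup>* x)\<close>.
  The number \<open>L\<close> stands for \<open>\<parallel>E(y\<^sup>* y)\<parallel>\<close> and may be larger, so that it can be taken positive.\<close>

lemma E_cauchy_schwarz:
  assumes L: "L > 0" "norm (E (star y * y)) \<le> L"
  shows "(norm (E (star y * x)))\<^sup>2 \<le> L * norm (E (star x * x))"
proof -
  define b where "b = E (star y * x)"
  have b: "b \<in> B" "star b = E (star x * y)" by (simp_all add: b_def E_mem E_star[symmetric])
  define w where "w = L *\<^sub>R x - y * b"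
  have eq: "E (star w * w) = (L * L) *\<^sub>R E (star x * x) - L *\<^sub>R (star b * b) - L *\<^sub>R (star b * b)
      + star b * E (star y * y) * b"
  proof -
    have "star w * w = (L * L) *\<^sub>R (star x * x) - L *\<^sub>R (star x * y * b) - L *\<^sub>R (star b * (star y * x))
      + star b * (star y * y * b)"
      by (simp add: w_def algebra_simps)
    moreover have "E (star x * y * b) = star b * b"
      by (simp only: E_right[OF b(1)] b(2))
    moreover have "E (star b * (star y * x)) = star b * b"
      by (simp only: E_left[OF B_closure(10)[OF b(1)]] b_def[symmetric])
    moreover have "E (star b * (star y * y * b)) = star b * E (star y * y) * b"
      by (simp only: E_left[OF B_closure(10)[OF b(1)]] E_right[OF b(1)]) (simp only: mult.assoc)
    ultimately show ?thesis by (simp only: E_add E_diff E_scaleR)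
  qed
  have "psd (E (star w * w))" by (rule psd_E_star_mult_self)
  moreover have "psd (star b * (L *\<^sub>R 1 - E (star y * y)) * b)"
  proof (rule psd_conjugate)
    have "psd ((L - norm (E (star y * y))) *\<^sub>R (1::'a))" using L by (simp add: psd_of_real_iff)
    from psd_add[OF this psd_norm_minus[OF psd_selfadjoint[OF psd_E_star_mult_self[of y]]]]
    show "psd (L *\<^sub>R 1 - E (star y * y))" by (simp add: algebra_simps)
  qed
  ultimately have "psd (E (star w * w) + star b * (L *\<^sub>R 1 - E (star y * y)) * b)"
    by (intro psd_add)
  moreover have "E (star w * w) + star b * (L *\<^sub>R 1 - E (star y * y)) * b
      = (L * L) *\<^sub>R E (star x * x) - L *\<^sub>R (star b * b)"
    unfolding eq by (simp add: algebra_simps)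
  ultimately have "psd ((L * L) *\<^sub>R E (star x * x) - L *\<^sub>R (star b * b))"
    by (simp only:)
  then have "norm (L *\<^sub>R (star b * b)) \<le> norm ((L * L) *\<^sub>R E (star x * x))"
    using L by (intro norm_mono_psd psd_scaleR psd_star_mult_self) auto
  then have "L * (norm b)\<^sup>2 \<le> L * (L * norm (E (star x * x)))"
    using L by (simp add: cstar_identity abs_mult)
  then show ?thesis using L by (simp add: b_def)
qed

text \<open>The summand \<open>1\<close> keeps the constants in the Cauchy-Schwarz inequality positive.\<close>

definition \<kappa> :: real where
  "\<kappa> = (\<Sum>i<n. sqrt (norm (E (star (l i) * l i)) + 1) * norm (l i))"

lemma \<kappa>_nonneg: "\<kappa> \<ge> 0"
  by (auto simp: \<kappa>_def intro!: sum_nonneg mult_nonneg_nonneg)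

text \<open>This is where finite index enters: up to a constant, the norm of the Hilbert module dominates
  that of the algebra. It follows from the Cauchy-Schwarz inequality for the coefficients of the quasi-basis
  expansion of \<open>x\<^sup>*\<close>.\<close>

lemma norm_le_E: "norm x \<le> \<kappa> * sqrt (norm (E (star x * x)))"
proof -
  let ?L = "\<lambda>i. norm (E (star (l i) * l i)) + 1"
  have "norm (E (star x * l i)) \<le> sqrt (?L i) * sqrt (norm (E (star x * x)))" for i
  proof -
    have "star (E (star x * l i)) = E (star (l i) * x)" by (simp add: E_star[symmetric])
    then have "(norm (E (star x * l i)))\<^sup>2 \<le> ?L i * norm (E (star x * x))"
      using E_cauchy_schwarz[of "?L i" "l i" x] norm_star[of "E (star x * l i)"]
      by (simp add: add_nonneg_pos)
    then show ?thesis by (simp add: real_le_rsqrt real_sqrt_mult[symmetric])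
  qed
  then have *: "norm (E (star x * l i) * star (l i)) \<le> sqrt (?L i) * norm (l i) * sqrt (norm (E (star x * x)))" for i
    by (intro order_trans[OF norm_mult_ineq]) (simp add: mult.commute mult.left_commute mult_left_mono)
  have "norm x = norm (star x)" by simp
  also have "\<dots> = norm (\<Sum>i<n. E (star x * l i) * star (l i))"
    by (subst quasi_basis[of "star x"]) simp
  also have "\<dots> \<le> (\<Sum>i<n. sqrt (?L i) * norm (l i) * sqrt (norm (E (star x * x))))"
    by (intro sum_norm_le *)
  also have "\<dots> = \<kappa> * sqrt (norm (E (star x * x)))" by (simp add: \<kappa>_def sum_distrib_right)
  finally show ?thesis .
qed

definition orthonormal :: "'a set \<Rightarrow> bool" where
  "orthonormal V \<longleftrightarrow> finite V \<and> (\<forall>v\<in>V. \<forall>w\<in>V. E (star v * w) = (if v = w then 1 else 0))"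

text \<open>For orthonormal \<open>V\<close> this is the orthogonal projection of the right Hilbert \<open>B\<close>-module onto the span
  of \<open>V\<close>.\<close>

definition proj :: "'a set \<Rightarrow> 'a \<Rightarrow> 'a" where
  "proj V x = (\<Sum>v\<in>V. v * E (star v * x))"

text \<open>Bessel's inequality: \<open>E(x\<^sup>* x) = E(p\<^sup>* p) + E((x - p)\<^sup>* (x - p))\<close> for \<open>p = proj V x\<close>.\<close>

lemma proj_bessel:
  assumes V: "orthonormal V"
  shows "norm (E (star (proj V x) * proj V x)) \<le> norm (E (star x * x))"
proof -
  define p where "p = proj V x"
  define S where "S = (\<Sum>v\<in>V. E (star x * v) * E (star v * x))"
  have px: "E (star y * p) = (\<Sum>v\<in>V. E (star y * v) * E (star v * x))" for y
    by (simp add: p_def proj_def sum_distrib_left E_sum mult.assoc[symmetric] E_right E_mem)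
  have vp: "E (star v * p) = E (star v * x)" if "v \<in> V" for v
  proof -
    have "E (star v * p) = (\<Sum>w\<in>V. if v = w then E (star w * x) else 0)"
      unfolding px using V that by (intro sum.cong) (auto simp: orthonormal_def)
    then show ?thesis using V that by (simp add: orthonormal_def)
  qed
  have star_p: "star p = (\<Sum>v\<in>V. E (star x * v) * star v)"
    by (simp add: p_def proj_def E_star[symmetric])
  have ps: "E (star p * y) = (\<Sum>v\<in>V. E (star x * v) * E (star v * y))" for y
    by (simp add: star_p sum_distrib_right E_sum mult.assoc E_left E_mem)
  have "E (star x * p) = S" "E (star p * x) = S" "E (star p * p) = S"
    unfolding S_def by (simp_all add: px[of x] ps[of x] ps[of p] vp)
  then have "E (star (x - p) * (x - p)) = E (star x * x) - E (star p * p)"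
    by (simp add: algebra_simps E_diff E_add)
  then have "psd (E (star x * x) - E (star p * p))" using psd_E_star_mult_self[of "x - p"] by simp
  then show ?thesis unfolding p_def[symmetric] by (intro norm_mono_psd psd_E_star_mult_self)
qed

text \<open>Expanding the factors \<open>v\<^sup>*\<close> in the quasi-basis gives \<open>\<Sum> v v\<^sup>* = \<Sum>\<^sub>i P(l\<^sub>i) l\<^sub>i\<^sup>*\<close> for the projection
  \<open>P = proj V\<close>. As \<open>P\<close> contracts the Hilbert module norm, the norms of the \<open>P(l\<^sub>i)\<close> are bounded
  independently of \<open>V\<close>.\<close>

lemma orthonormal_bound:
  assumes V: "orthonormal V"
  shows "norm (\<Sum>v\<in>V. v * star v) \<le> \<kappa>\<^sup>2"
proof -
  have "(\<Sum>v\<in>V. v * star v) = (\<Sum>v\<in>V. v * (\<Sum>i<n. E (star v * l i) * star (l i)))"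
    by (intro sum.cong refl arg_cong2[where f = "(*)"] quasi_basis)
  also have "\<dots> = (\<Sum>i<n. proj V (l i) * star (l i))"
    unfolding proj_def sum_distrib_left sum_distrib_right mult.assoc[symmetric] by (rule sum.swap)
  finally have *: "(\<Sum>v\<in>V. v * star v) = (\<Sum>i<n. proj V (l i) * star (l i))" .
  have "norm (proj V (l i) * star (l i)) \<le>
      \<kappa> * (sqrt (norm (E (star (l i) * l i)) + 1) * norm (l i))" for i
  proof -
    have "norm (proj V (l i)) \<le> \<kappa> * sqrt (norm (E (star (proj V (l i)) * proj V (l i))))"
      by (rule norm_le_E)
    also have "\<dots> \<le> \<kappa> * sqrt (norm (E (star (l i) * l i)) + 1)"
      using proj_bessel[OF V, of "l i"] \<kappa>_nonneg
      by (intro mult_left_mono real_sqrt_le_mono) auto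
    finally have "norm (proj V (l i)) * norm (l i) \<le>
        \<kappa> * sqrt (norm (E (star (l i) * l i)) + 1) * norm (l i)"
      by (intro mult_right_mono) auto
    then show ?thesis
      using norm_mult_ineq[of "proj V (l i)" "star (l i)"] by (simp add: mult.assoc)
  qed
  then have "norm (\<Sum>v\<in>V. v * star v) \<le>
      (\<Sum>i<n. \<kappa> * (sqrt (norm (E (star (l i) * l i)) + 1) * norm (l i)))"
    unfolding * by (intro sum_norm_le)
  also have "\<dots> = \<kappa> * \<kappa>"
    unfolding sum_distrib_left[symmetric] by (simp only: \<kappa>_def[symmetric])
  finally show ?thesis by (simp add: power2_eq_square)
qed

lemma orthonormal_unitaries_card:
  assumes "orthonormal V" "V \<subseteq> unitaries UNIV"
  shows "real (card V) \<le> \<kappa>\<^sup>2"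
proof -
  have "(\<Sum>v\<in>V. v * star v) = (\<Sum>v\<in>V. 1)"
    using assms(2) by (intro sum.cong) (auto simp: unitaries_def)
  then show ?thesis using orthonormal_bound[OF assms(1)] by simp
qed

end

section \<open>The centralizer\<close>

lemma centralizer_commute: "r \<in> centralizer B \<Longrightarrow> b \<in> B \<Longrightarrow> r * b = b * r"
  by (simp add: centralizer_def)

lemma centralizer_unital_cstar_subalgebra:
  assumes B: "\<And>b. b \<in> B \<Longrightarrow> star b \<in> B"
  shows "unital_cstar_subalgebra (centralizer B)"
proof -
  have "centralizer B = (\<Inter>b\<in>B. (\<lambda>x. x * b - b * x) -` {0})" by (auto simp: centralizer_def)
  moreover have "closed ((\<lambda>x. x * b - b * x) -` {0})" for b :: 'a
    by (intro continuous_closed_vimage) (auto intro!: continuous_intros)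
  ultimately have "closed (centralizer B)" by auto
  moreover have "star x \<in> centralizer B" if x: "x \<in> centralizer B" for x
  proof -
    have "star x * b = b * star x" if "b \<in> B" for b
      using arg_cong[OF centralizer_commute[OF x B[OF that]], of star] by simp
    then show ?thesis by (simp add: centralizer_def)
  qed
  moreover have "x * y \<in> centralizer B" if "x \<in> centralizer B" "y \<in> centralizer B" for x y
  proof -
    have "(x * y) * b = b * (x * y)" if b: "b \<in> B" for b
    proof -
      have "(x * y) * b = (x * b) * y"
        using centralizer_commute[OF \<open>y \<in> centralizer B\<close> b] by (simp add: mult.assoc)
      then show ?thesis
        using centralizer_commute[OF \<open>x \<in> centralizer B\<close> b] by (simp add: mult.assoc)
    qed
    then show ?thesis by (simp add: centralizer_def)
  qed
  moreover have "x + y \<in> centralizer B" if "x \<in> centralizer B" "y \<in> centralizer B" for x y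
    using that by (simp add: centralizer_def distrib_left distrib_right)
  moreover have "c *\<^sub>C x \<in> centralizer B" if "x \<in> centralizer B" for c x
    using that by (simp add: centralizer_def)
  moreover have "0 \<in> centralizer B" "1 \<in> centralizer B" by (simp_all add: centralizer_def)
  ultimately show ?thesis
    unfolding unital_cstar_subalgebra_def cstar_subalgebra_def by simp
qed

locale simple_finite_index_expectation = finite_index_expectation +
  assumes simple: "simple_cstar B"
begin

abbreviation "R \<equiv> centralizer B"

lemma R_unital: "unital_cstar_subalgebra R"
  by (rule centralizer_unital_cstar_subalgebra) (rule B_closure)

lemmas R_closure = unital_cstar_subalgebra_closure[OF R_unital]

lemma E_R_scalar:
  assumes r: "r \<in> R"
  shows "\<exists>c. E r = c *\<^sub>C 1"
proof (rule central_scalar[OF subalgebra simple E_mem])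
  fix b assume b: "b \<in> B"
  show "E r * b = b * E r"
    using E_left[OF b, of r] E_right[OF b, of r] centralizer_commute[OF r b] by simp
qed

lemma E_R_star_mult_self:
  assumes "r \<in> R"
  shows "\<exists>\<rho>\<ge>0. E (star r * r) = \<rho> *\<^sub>R 1"
proof -
  obtain c where c: "E (star r * r) = c *\<^sub>C 1"
    using E_R_scalar[OF R_closure(6)[OF R_closure(10)[OF assms] assms]] by blast
  obtain \<rho> where "\<rho> \<ge> 0" "c = complex_of_real \<rho>"
    using psd_scalar[of c] psd_E_star_mult_self[of r] unfolding c by blast
  then show ?thesis using c by (auto simp: scaleR_scaleC)
qed

text \<open>For \<open>v \<in> R\<close> the element \<open>E(v v\<^sup>*)\<close> is a scalar, at least \<open>\<kappa>\<^sup>-\<^sup>2\<close> if \<open>E(v\<^sup>* v) = 1\<close>. Summing over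
  \<open>V\<close> and applying the bound for \<open>\<Sum> v v\<^sup>*\<close> limits the number of summands.\<close>

lemma orthonormal_centralizer_card:
  assumes V: "orthonormal V" "V \<subseteq> R"
  shows "real (card V) \<le> 6 * (\<kappa>\<^sup>2 * \<kappa>\<^sup>2)"
proof -
  have "\<exists>\<rho>\<ge>0. E (v * star v) = \<rho> *\<^sub>R 1" if "v \<in> V" for v
    using E_R_star_mult_self[OF R_closure(10), of v] that V(2) by auto
  then obtain \<rho> where \<rho>: "\<And>v. v \<in> V \<Longrightarrow> \<rho> v \<ge> 0 \<and> E (v * star v) = \<rho> v *\<^sub>R 1" by metis
  have 1: "1 \<le> \<kappa>\<^sup>2 * \<rho> v" if "v \<in> V" for v
  proof -
    have "psd (E ((norm v)\<^sup>2 *\<^sub>R 1 - star v * v))"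
      using psd_E[OF psd_norm_minus[of "star v * v"]] by (simp add: cstar_identity)
    moreover have "E (star v * v) = 1" using V that by (simp add: orthonormal_def)
    ultimately have "psd (((norm v)\<^sup>2 - 1) *\<^sub>R (1::'a))"
      by (simp add: E_diff E_scaleR E_id[OF B_closure(1)] algebra_simps)
    then have "1 \<le> (norm v)\<^sup>2" by (simp add: psd_of_real_iff)
    also have "\<dots> = (norm (star v))\<^sup>2" by simp
    also have "\<dots> \<le> (\<kappa> * sqrt (norm (E (star (star v) * star v))))\<^sup>2"
      by (intro power_mono norm_le_E) simp
    also have "\<dots> = \<kappa>\<^sup>2 * \<rho> v" using \<rho>[OF that] by (simp add: power_mult_distrib)
    finally show ?thesis .
  qed
  have "E (\<Sum>v\<in>V. v * star v) = (\<Sum>v\<in>V. \<rho> v) *\<^sub>R 1"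
    using \<rho> by (simp add: E_sum scaleR_left.sum)
  then have "norm (E (\<Sum>v\<in>V. v * star v)) = (\<Sum>v\<in>V. \<rho> v)"
    using \<rho> by (simp add: sum_nonneg)
  then have 2: "(\<Sum>v\<in>V. \<rho> v) \<le> 6 * \<kappa>\<^sup>2"
    using norm_E_le[of "\<Sum>v\<in>V. v * star v"] orthonormal_bound[OF V(1)] by linarith
  have "real (card V) = (\<Sum>v\<in>V. 1)" by simp
  also have "\<dots> \<le> (\<Sum>v\<in>V. \<kappa>\<^sup>2 * \<rho> v)" by (intro sum_mono 1)
  also have "\<dots> = \<kappa>\<^sup>2 * (\<Sum>v\<in>V. \<rho> v)" by (simp add: sum_distrib_left)
  also have "\<dots> \<le> \<kappa>\<^sup>2 * (6 * \<kappa>\<^sup>2)" by (intro mult_left_mono 2) simp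
  finally show ?thesis by (simp only: mult.left_commute[of "\<kappa>\<^sup>2" 6])
qed

text \<open>An orthonormal subset of \<open>R\<close> of greatest cardinality works: if \<open>r - proj V r\<close> were nonzero, its
  normalization could be added to \<open>V\<close>. The normalization exists since \<open>E\<close> is scalar on \<open>R\<close>.\<close>

lemma centralizer_orthonormal_basis:
  obtains V where "orthonormal V" "V \<subseteq> R" "\<And>r. r \<in> R \<Longrightarrow> proj V r = r"
proof -
  let ?P = "\<lambda>k. \<exists>V. orthonormal V \<and> V \<subseteq> R \<and> card V = k"
  let ?k = "Greatest ?P"
  have P0: "?P 0" by (intro exI[of _ "{}"]) (simp add: orthonormal_def)
  have bound: "k \<le> nat \<lfloor>6 * (\<kappa>\<^sup>2 * \<kappa>\<^sup>2)\<rfloor>" if "?P k" for k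
    using orthonormal_centralizer_card that by (metis le_nat_floor)
  have "?P ?k" by (rule GreatestI_nat[of ?P, OF P0 bound])
  then obtain V where V: "orthonormal V" "V \<subseteq> R" "card V = ?k" by blast
  have "proj V r = r" if r: "r \<in> R" for r
  proof (rule ccontr)
    assume "proj V r \<noteq> r"
    define s where "s = r - proj V r"
    have vr: "star v * r \<in> R" if "v \<in> V" for v
      using V(2) that by (intro R_closure r) auto
    have "v * E (star v * r) \<in> R" if v: "v \<in> V" for v
    proof -
      obtain c where c: "E (star v * r) = c *\<^sub>C 1" using E_R_scalar[OF vr[OF v]] by blast
      have "c *\<^sub>C v \<in> R" using V(2) v by (intro R_closure) auto
      then show ?thesis by (simp add: c)
    qed
    then have "proj V r \<in> R" unfolding proj_def by (rule R_closure(11))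
    with r have s: "s \<in> R" unfolding s_def by (rule R_closure(5))
    have vs: "E (star v * s) = 0" if v: "v \<in> V" for v
    proof -
      have "E (star v * proj V r) = (\<Sum>w\<in>V. E (star v * w) * E (star w * r))"
        by (simp add: proj_def sum_distrib_left E_sum mult.assoc[symmetric] E_right E_mem)
      also have "\<dots> = (\<Sum>w\<in>V. if v = w then E (star w * r) else 0)"
        using V v by (intro sum.cong) (auto simp: orthonormal_def)
      also have "\<dots> = E (star v * r)" using V v by (simp add: orthonormal_def)
      finally show ?thesis by (simp add: s_def right_diff_distrib E_diff)
    qed
    have sv: "E (star s * v) = 0" if "v \<in> V" for v
      using vs[OF that] E_star[of "star v * s"] by simp
    obtain \<rho> where \<rho>: "\<rho> \<ge> 0" "E (star s * s) = \<rho> *\<^sub>R 1" using E_R_star_mult_self[OF s] by blast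
    have "\<rho> \<noteq> 0" using norm_le_E[of s] \<rho> \<open>proj V r \<noteq> r\<close> by (auto simp: s_def)
    define t where "t = (1 / sqrt \<rho>) *\<^sub>R s"
    have "1 / sqrt \<rho> * (1 / sqrt \<rho>) = 1 / \<rho>" using \<rho> by simp
    then have tt: "E (star t * t) = 1" using \<open>\<rho> \<noteq> 0\<close> by (simp add: t_def E_scaleR \<rho>(2))
    have tv: "E (star t * v) = 0" "E (star v * t) = 0" if "v \<in> V" for v
      using vs[OF that] sv[OF that] by (simp_all add: t_def E_scaleR)
    have "t \<notin> V" using tv(1)[of t] tt by auto
    moreover have "orthonormal (insert t V)"
      using V(1) tv tt \<open>t \<notin> V\<close> by (auto simp: orthonormal_def)
    moreover have "t \<in> R" unfolding t_def by (intro R_closure s)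
    ultimately have "?P (Suc ?k)"
      using V by (intro exI[of _ "insert t V"]) (auto simp: orthonormal_def)
    from Greatest_le_nat[of ?P, OF this bound] show False by simp
  qed
  then show ?thesis using V that by blast
qed

end

locale centralizer_basis = simple_finite_index_expectation +
  fixes V :: "'a set"
  assumes V: "orthonormal V" "V \<subseteq> R" and basis: "r \<in> R \<Longrightarrow> proj V r = r"
begin

text \<open>This is the C*-algebra generated by \<open>B\<close> and its centralizer, shown in \<open>C_eq\<close>. Describing it by
  fixed points of a bounded map makes it evidently closed.\<close>

definition C :: "'a set" where
  "C = {x. proj V x = x}"

lemma proj_add: "proj V (x + y) = proj V x + proj V y"
  by (simp add: proj_def distrib_left E_add sum.distrib)

lemma proj_scaleC: "proj V (c *\<^sub>C x) = c *\<^sub>C proj V x"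
  by (simp add: proj_def E_scaleC scaleC_sum_right)

lemma proj_right: "b \<in> B \<Longrightarrow> proj V (x * b) = proj V x * b"
  by (simp add: proj_def mult.assoc[symmetric] E_right sum_distrib_right)

lemma proj_sum: "proj V (sum f A) = (\<Sum>i\<in>A. proj V (f i))"
proof -
  have "proj V 0 = 0" by (simp add: proj_def)
  then show ?thesis by (induction A rule: infinite_finite_induct) (simp_all add: proj_add)
qed

lemma bounded_linear_proj: "bounded_linear (proj V)"
  unfolding proj_def
  by (intro bounded_linear_sum bounded_linear_const_mult bounded_linear_E
      bounded_linear_compose[OF bounded_linear_E bounded_linear_mult_right])

lemma R_mult_B_in_C: "r \<in> R \<Longrightarrow> b \<in> B \<Longrightarrow> r * b \<in> C"
  by (simp add: C_def proj_right basis)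

lemma R_subset_C: "R \<subseteq> C"
  by (auto simp: C_def basis)

lemma B_subset_C: "B \<subseteq> C"
  using R_mult_B_in_C[OF R_closure(1)] by auto

lemma C_expand:
  assumes "x \<in> C"
  shows "x = (\<Sum>v\<in>V. v * E (star v * x))"
  using assms by (simp add: C_def proj_def)

text \<open>Elements of \<open>C\<close> are sums of products \<open>v b\<close> with \<open>v \<in> V\<close> and \<open>b \<in> B\<close>; the rule hides the choice of \<open>V\<close>.
  The index sets have the type of subsets of \<open>V\<close>.\<close>

lemma C_induct [consumes 1, case_names base sum]:
  assumes x: "x \<in> C"
    and base: "\<And>r b. r \<in> R \<Longrightarrow> b \<in> B \<Longrightarrow> P (r * b)"
    and sum: "\<And>f (I::'a set). (\<And>i. i \<in> I \<Longrightarrow> P (f i)) \<Longrightarrow> P (sum f I)"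
  shows "P x"
  by (subst C_expand[OF x], rule sum, rule base) (use V E_mem in auto)

lemma proj_V_mem: "proj V x \<in> C"
proof -
  have "v * E (star v * x) \<in> C" if "v \<in> V" for v
    using V(2) that E_mem by (intro R_mult_B_in_C) auto
  then show ?thesis unfolding C_def proj_def[of V x] by (simp add: proj_sum)
qed

lemma C_sum: "(\<And>i. i \<in> I \<Longrightarrow> f i \<in> C) \<Longrightarrow> sum f I \<in> C"
  by (simp add: C_def proj_sum)

lemma C_unital: "unital_cstar_subalgebra C"
proof -
  have comm: "b * r = r * b" if "r \<in> R" "b \<in> B" for r b
    using centralizer_commute[OF that] by simp
  have "closed C"
    unfolding C_def
    by (intro closed_Collect_eq continuous_intros
        linear_continuous_on[OF bounded_linear_proj])
  moreover have "x * y \<in> C" if "x \<in> C" "y \<in> C" for x y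
    using \<open>x \<in> C\<close>
  proof (induction x rule: C_induct)
    case (base r b)
    show ?case using \<open>y \<in> C\<close>
    proof (induction y rule: C_induct)
      case (base s d)
      have "(r * b) * (s * d) = (r * s) * (b * d)"
        using comm[OF base(1) \<open>b \<in> B\<close>] by (metis mult.assoc)
      then show ?case using \<open>r \<in> R\<close> \<open>b \<in> B\<close> base by (simp add: R_mult_B_in_C R_closure B_closure)
    next
      case (sum f I)
      then show ?case unfolding sum_distrib_left by (rule C_sum)
    qed
  next
    case (sum f I)
    then show ?case unfolding sum_distrib_right by (rule C_sum)
  qed
  moreover have "star x \<in> C" if "x \<in> C" for x
    using that
  proof (induction x rule: C_induct)
    case (base r b)
    then show ?case using comm[of "star r" "star b"]
      by (simp add: R_mult_B_in_C R_closure B_closure)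
  next
    case (sum f I)
    then show ?case by (simp add: C_sum)
  qed
  ultimately show ?thesis
    using R_subset_C R_closure(1,3)
    unfolding unital_cstar_subalgebra_def cstar_subalgebra_def
    by (auto simp: C_def proj_add proj_scaleC)
qed

lemmas C_closure = unital_cstar_subalgebra_closure[OF C_unital]

lemma C_eq: "C = cstar_generated (B \<union> R)"
proof
  show "C \<subseteq> cstar_generated (B \<union> R)"
  proof (unfold cstar_generated_def, intro Inter_greatest subsetI)
    fix x T assume "T \<in> {T. cstar_subalgebra T \<and> B \<union> R \<subseteq> T}" and x: "x \<in> C"
    then have T: "cstar_subalgebra T" "B \<subseteq> T" "R \<subseteq> T" by auto
    show "x \<in> T" using x
    proof (induction x rule: C_induct)
      case (base r b)
      then show ?case using T(2,3) by (intro cstar_subalgebra_closure(5)[OF T(1)]) auto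
    next
      case (sum f I)
      then show ?case by (rule cstar_subalgebra_closure(10)[OF T(1)])
    qed
  qed
  show "cstar_generated (B \<union> R) \<subseteq> C"
    unfolding cstar_generated_def
    using unital_cstar_subalgebraD(1)[OF C_unital] B_subset_C R_subset_C by auto
qed

end

section \<open>The normalizer\<close>

lemma unitaries_cancel:
  assumes "u \<in> unitaries S"
  shows "star u * u = 1" "u * star u = 1" "star u * (u * x) = x" "u * (star u * x) = x"
proof -
  show 1: "star u * u = 1" and 2: "u * star u = 1" using assms by (simp_all add: unitaries_def)
  show "star u * (u * x) = x" "u * (star u * x) = x"
    by (simp_all add: mult.assoc[symmetric] 1 2)
qed

lemma normalizer_unitary: "u \<in> normalizer B \<Longrightarrow> u \<in> unitaries UNIV"
  by (simp add: normalizer_def)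

lemmas normalizer_cancel = unitaries_cancel[OF normalizer_unitary]

lemma conj_image_eqI:
  assumes "u \<in> unitaries S"
    and "\<And>b. b \<in> B \<Longrightarrow> u * b * star u \<in> B" "\<And>b. b \<in> B \<Longrightarrow> star u * b * u \<in> B"
  shows "(\<lambda>b. u * b * star u) ` B = B"
proof
  show "B \<subseteq> (\<lambda>b. u * b * star u) ` B"
  proof
    fix b assume b: "b \<in> B"
    have "b = u * (star u * b * u) * star u"
      by (simp add: mult.assoc unitaries_cancel[OF assms(1)])
    then show "b \<in> (\<lambda>b. u * b * star u) ` B" using assms(3)[OF b] by (rule image_eqI)
  qed
qed (use assms(2) in auto)

lemma normalizerI:
  assumes "u \<in> unitaries UNIV"
    and "\<And>b. b \<in> B \<Longrightarrow> u * b * star u \<in> B" "\<And>b. b \<in> B \<Longrightarrow> star u * b * u \<in> B"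
  shows "u \<in> normalizer B"
  using assms(1) conj_image_eqI[OF assms] by (simp add: normalizer_def)

lemma normalizer_conj:
  assumes "u \<in> normalizer B" "b \<in> B"
  shows "u * b * star u \<in> B"
proof -
  have "(\<lambda>b. u * b * star u) ` B = B" using assms(1) by (simp add: normalizer_def)
  then show ?thesis using assms(2) by (metis imageI)
qed

lemma normalizer_conj_star:
  assumes "u \<in> normalizer B" "b \<in> B"
  shows "star u * b * u \<in> B"
proof -
  have "(\<lambda>b. u * b * star u) ` B = B" using assms(1) by (simp add: normalizer_def)
  then have "b \<in> (\<lambda>b. u * b * star u) ` B" using assms(2) by simp
  then obtain b' where b': "b = u * b' * star u" "b' \<in> B" by (rule imageE)
  have "star u * b * u = b'" by (simp add: b'(1) mult.assoc normalizer_cancel[OF assms(1)])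
  then show ?thesis using b'(2) by simp
qed

lemma normalizer_one: "1 \<in> normalizer B"
  by (rule normalizerI) (simp_all add: unitaries_def)

lemma normalizer_star:
  assumes "u \<in> normalizer B"
  shows "star u \<in> normalizer B"
  by (rule normalizerI)
    (use normalizer_conj[OF assms] normalizer_conj_star[OF assms] normalizer_cancel[OF assms]
      in \<open>simp_all add: unitaries_def\<close>)

lemma normalizer_mult:
  assumes u: "u \<in> normalizer B" and v: "v \<in> normalizer B"
  shows "u * v \<in> normalizer B"
proof (rule normalizerI)
  show "u * v \<in> unitaries UNIV"
    by (simp add: unitaries_def mult.assoc normalizer_cancel[OF u] normalizer_cancel[OF v])
next
  fix b assume "b \<in> B"
  then show "u * v * b * star (u * v) \<in> B"
    using normalizer_conj[OF u normalizer_conj[OF v]] by (simp add: mult.assoc)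
next
  fix b assume "b \<in> B"
  then show "star (u * v) * b * (u * v) \<in> B"
    using normalizer_conj_star[OF v normalizer_conj_star[OF u]] by (simp add: mult.assoc)
qed

lemma unitaries_subset_normalizer:
  assumes "unital_cstar_subalgebra B"
  shows "unitaries B \<subseteq> normalizer B"
proof
  fix u assume u: "u \<in> unitaries B"
  note closure = unital_cstar_subalgebra_closure[OF assms]
  show "u \<in> normalizer B"
    by (rule normalizerI) (use u in \<open>simp_all add: unitaries_def closure\<close>)
qed

lemma centralizer_unitaries_subset_normalizer: "unitaries (centralizer B) \<subseteq> normalizer B"
proof
  fix u assume u: "u \<in> unitaries (centralizer B)"
  then have comm: "u * b = b * u" if "b \<in> B" for b
    using that by (simp add: unitaries_def centralizer_def)
  show "u \<in> normalizer B"
  proof (rule normalizerI)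
    show "u \<in> unitaries UNIV" using u by (simp add: unitaries_def)
    show "u * b * star u \<in> B" if "b \<in> B" for b
      using that by (simp add: comm mult.assoc unitaries_cancel[OF u])
    show "star u * b * u \<in> B" if "b \<in> B" for b
      using that by (simp add: comm[symmetric] mult.assoc unitaries_cancel[OF u])
  qed
qed

lemma automorphism_conj:
  assumes u: "u \<in> unitaries S" and T: "(\<lambda>x. u * x * star u) ` T = T"
  shows "automorphism T (\<lambda>x. u * x * star u)"
proof -
  have "inj_on (\<lambda>x. u * x * star u) T"
    by (rule inj_on_inverseI[where g = "\<lambda>x. star u * x * u"])
      (simp add: mult.assoc unitaries_cancel[OF u])
  then have "bij_betw (\<lambda>x. u * x * star u) T T" using T by (simp only: bij_betw_def)
  then show ?thesis
    unfolding automorphism_def star_isomorphism_def cstar_of_def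
    by (simp add: distrib_left distrib_right mult.assoc unitaries_cancel[OF u])
qed

section \<open>Classes of normalizers modulo those acting by inner automorphisms\<close>

context centralizer_basis
begin

abbreviation "N \<equiv> normalizer B"

text \<open>The kernel of the action of the normalizer on \<open>B\<close> modulo inner automorphisms.\<close>

definition H :: "'a set" where
  "H = {u \<in> N. inner_automorphism B (\<lambda>b. u * b * star u)}"

lemma H_subset_N: "H \<subseteq> N"
  by (auto simp: H_def)

lemma H_I:
  assumes "u \<in> N" "w \<in> unitaries B" "\<And>b. b \<in> B \<Longrightarrow> u * b * star u = w * b * star w"
  shows "u \<in> H"
  using assms unfolding H_def inner_automorphism_def by blast

lemma H_E:
  assumes "u \<in> H"
  obtains w where "u \<in> N" "w \<in> unitaries B" "\<And>b. b \<in> B \<Longrightarrow> u * b * star u = w * b * star w"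
  using assms unfolding H_def inner_automorphism_def by blast

lemma H_one: "1 \<in> H"
  by (rule H_I[OF normalizer_one, of 1]) (simp_all add: unitaries_def B_closure)

lemma H_mult:
  assumes "u \<in> H" "v \<in> H"
  shows "u * v \<in> H"
proof -
  obtain w where u: "u \<in> N" and w: "w \<in> unitaries B" "\<And>b. b \<in> B \<Longrightarrow> u * b * star u = w * b * star w"
    using assms(1) by (rule H_E) blast
  obtain w' where v: "v \<in> N" and w': "w' \<in> unitaries B" "\<And>b. b \<in> B \<Longrightarrow> v * b * star v = w' * b * star w'"
    using assms(2) by (rule H_E) blast
  show ?thesis
  proof (rule H_I[of _ "w * w'"])
    show "u * v \<in> N" by (rule normalizer_mult[OF u v])
    have "w * w' \<in> B" using w(1) w'(1) by (simp add: unitaries_def B_closure)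
    then show "w * w' \<in> unitaries B"
      by (simp add: unitaries_def mult.assoc unitaries_cancel[OF w(1)] unitaries_cancel[OF w'(1)])
  next
    fix b assume b: "b \<in> B"
    have "u * v * b * star (u * v) = u * (v * b * star v) * star u" by (simp add: mult.assoc)
    also have "\<dots> = w * (v * b * star v) * star w" by (rule w(2)[OF normalizer_conj[OF v b]])
    also have "\<dots> = w * (w' * b * star w') * star w" by (simp only: w'(2)[OF b])
    finally show "u * v * b * star (u * v) = w * w' * b * star (w * w')" by (simp add: mult.assoc)
  qed
qed

lemma H_star:
  assumes "u \<in> H"
  shows "star u \<in> H"
proof -
  obtain w where u: "u \<in> N" and w: "w \<in> unitaries B" "\<And>b. b \<in> B \<Longrightarrow> u * b * star u = w * b * star w"
    using assms by (rule H_E) blast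
  show ?thesis
  proof (rule H_I[of _ "star w"])
    show "star u \<in> N" by (rule normalizer_star[OF u])
    show "star w \<in> unitaries B" using w(1) by (simp add: unitaries_def B_closure)
    fix b assume b: "b \<in> B"
    define d where "d = star u * b * u"
    have "u * d * star u = b" by (simp add: d_def mult.assoc normalizer_cancel[OF u])
    moreover have "d \<in> B" unfolding d_def by (rule normalizer_conj_star[OF u b])
    ultimately have "b = w * d * star w" using w(2) by simp
    then have "star w * b * w = d" by (simp add: mult.assoc unitaries_cancel[OF w(1)])
    then show "star u * b * star (star u) = star w * b * star (star w)" by (simp add: d_def)
  qed
qed

lemma H_conj:
  assumes "u \<in> H" and v: "v \<in> N"
  shows "v * u * star v \<in> H"
proof -
  obtain w where u: "u \<in> N" and w: "w \<in> unitaries B" "\<And>b. b \<in> B \<Longrightarrow> u * b * star u = w * b * star w"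
    using assms(1) by (rule H_E) blast
  show ?thesis
  proof (rule H_I[of _ "v * w * star v"])
    show "v * u * star v \<in> N" by (intro normalizer_mult normalizer_star u v)
    have "v * w * star v \<in> B" using w(1) by (intro normalizer_conj[OF v]) (simp add: unitaries_def)
    then show "v * w * star v \<in> unitaries B"
      by (simp add: unitaries_def mult.assoc unitaries_cancel[OF w(1)] normalizer_cancel[OF v])
  next
    fix b assume b: "b \<in> B"
    have "v * u * star v * b * star (v * u * star v) = v * (u * (star v * b * v) * star u) * star v"
      by (simp add: mult.assoc)
    also have "\<dots> = v * (w * (star v * b * v) * star w) * star v"
      by (simp only: w(2)[OF normalizer_conj_star[OF v b]])
    finally show "v * u * star v * b * star (v * u * star v)
        = v * w * star v * b * star (v * w * star v)"
      by (simp add: mult.assoc)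
  qed
qed

text \<open>If \<open>u\<close> acts like \<open>w \<in> B\<close>, then \<open>w\<^sup>* u\<close> centralizes \<open>B\<close>.\<close>

lemma H_subset_C: "H \<subseteq> C"
proof
  fix u assume "u \<in> H"
  then obtain w where u: "u \<in> N" and w: "w \<in> unitaries B" "\<And>b. b \<in> B \<Longrightarrow> u * b * star u = w * b * star w"
    by (rule H_E) blast
  have "star w * u * b = b * (star w * u)" if "b \<in> B" for b
  proof -
    have "star w * u * b = star w * (u * b * star u) * u"
      by (simp add: mult.assoc normalizer_cancel[OF u])
    also have "\<dots> = star w * (w * b * star w) * u" by (simp only: w(2)[OF that])
    also have "\<dots> = b * (star w * u)" by (simp add: mult.assoc unitaries_cancel[OF w(1)])
    finally show ?thesis .
  qed
  then have "star w * u \<in> R" by (simp add: centralizer_def)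
  moreover have "w \<in> C" using w(1) B_subset_C by (auto simp: unitaries_def)
  ultimately have "w * (star w * u) \<in> C" by (intro C_closure(6)[OF _ subsetD[OF R_subset_C]])
  then show "u \<in> C" by (simp add: unitaries_cancel[OF w(1)])
qed

text \<open>For \<open>r \<in> R\<close>, the element \<open>E(r u)\<close> intertwines the identity of \<open>B\<close> with the action of \<open>u\<close>.\<close>

lemma E_C_mult_outer:
  assumes u: "u \<in> N" "u \<notin> H" and c: "c \<in> C"
  shows "E (c * u) = 0"
  using c
proof (induction c rule: C_induct)
  case (base r b)
  have "E (r * u) = 0"
  proof (rule ccontr)
    assume nz: "E (r * u) \<noteq> 0"
    have "\<exists>w\<in>unitaries B. \<forall>b\<in>B. u * b * star u = w * b * star w"
    proof (rule intertwiner_inner[OF subalgebra simple E_mem nz])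
      show "(\<lambda>b. u * b * star u) ` B = B" using u(1) by (simp add: normalizer_def)
      fix b assume b: "b \<in> B"
      show "u * star b * star u = star (u * b * star u)" by (simp add: mult.assoc)
      have "E (r * u) * b = E (r * (u * b * star u) * u)"
        using E_right[OF b, of "r * u"] by (simp add: mult.assoc normalizer_cancel[OF u(1)])
      also have "\<dots> = E ((u * b * star u) * (r * u))"
        using centralizer_commute[OF base(1) normalizer_conj[OF u(1) b]] by (simp only: mult.assoc)
      also have "\<dots> = (u * b * star u) * E (r * u)"
        by (rule E_left[OF normalizer_conj[OF u(1) b]])
      finally show "E (r * u) * b = u * b * star u * E (r * u)" .
    qed
    then show False using u unfolding H_def inner_automorphism_def by blast
  qed
  then show ?case
    using E_left[OF base(2), of "r * u"] centralizer_commute[OF base] by (simp add: mult.assoc)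
next
  case (sum f I)
  then show ?case by (simp add: sum_distrib_right E_sum)
qed

lemma proj_C_mult_outer:
  assumes u: "u \<in> N" "u \<notin> H" and c: "c \<in> C"
  shows "proj V (c * u) = 0"
proof -
  have "E (star v * (c * u)) = 0" if "v \<in> V" for v
  proof -
    have "star v * c \<in> C" using that V(2) R_subset_C c by (intro C_closure) auto
    from E_C_mult_outer[OF u this] show ?thesis by (simp add: mult.assoc)
  qed
  then show ?thesis by (simp add: proj_def)
qed

lemma C_conj:
  assumes u: "u \<in> N" and c: "c \<in> C"
  shows "u * c * star u \<in> C"
  using c
proof (induction c rule: C_induct)
  case (base r b)
  have "u * r * star u * b = b * (u * r * star u)" if b: "b \<in> B" for b
  proof -
    have "u * r * star u * b = u * (r * (star u * b * u)) * star u"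
      by (simp add: mult.assoc normalizer_cancel[OF u])
    also have "\<dots> = u * ((star u * b * u) * r) * star u"
      by (simp only: centralizer_commute[OF base(1) normalizer_conj_star[OF u b]])
    finally show ?thesis by (simp add: mult.assoc normalizer_cancel[OF u])
  qed
  then have "u * r * star u \<in> R" by (simp add: centralizer_def)
  from R_mult_B_in_C[OF this normalizer_conj[OF u base(2)]]
  show ?case by (simp add: mult.assoc normalizer_cancel[OF u])
next
  case (sum f I)
  then show ?case by (simp add: sum_distrib_left sum_distrib_right C_sum)
qed

lemma C_conj_star:
  assumes "u \<in> N" "c \<in> C"
  shows "star u * c * u \<in> C"
  using C_conj[OF normalizer_star[OF assms(1)] assms(2)] by simp

definition normalizer_class :: "'a \<Rightarrow> 'a set" where
  "normalizer_class a = {b \<in> N. a * star b \<in> H}"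

lemma normalizer_class_eq_iff:
  assumes a: "a \<in> N" and b: "b \<in> N"
  shows "normalizer_class a = normalizer_class b \<longleftrightarrow> a * star b \<in> H"
proof
  assume eq: "normalizer_class a = normalizer_class b"
  have "b \<in> normalizer_class b"
    using b H_one by (simp add: normalizer_class_def normalizer_cancel[OF b])
  then show "a * star b \<in> H" unfolding eq[symmetric] by (simp add: normalizer_class_def)
next
  have sub: "normalizer_class a \<subseteq> normalizer_class b" if "a * star b \<in> H" "a \<in> N" for a b
  proof
    fix c assume c: "c \<in> normalizer_class a"
    have "star (a * star b) * (a * star c) \<in> H"
      by (rule H_mult[OF H_star[OF that(1)]]) (use c in \<open>simp add: normalizer_class_def\<close>)
    then have "b * star c \<in> H" by (simp add: mult.assoc normalizer_cancel[OF that(2)])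
    then show "c \<in> normalizer_class b" using c by (simp add: normalizer_class_def)
  qed
  assume ab: "a * star b \<in> H"
  then have "b * star a \<in> H" using H_star[OF ab] by simp
  then show "normalizer_class a = normalizer_class b" using sub ab a b by blast
qed

text \<open>The adjoints of inequivalent normalizers are orthonormal, as \<open>E(u v\<^sup>*) = 0\<close>.\<close>

lemma finite_normalizer_classes: "finite (normalizer_class ` N)"
proof -
  have "card G \<le> nat \<lfloor>\<kappa>\<^sup>2\<rfloor>" if G: "G \<subseteq> normalizer_class ` N" "finite G" for G
  proof -
    obtain T where T: "T \<subseteq> N" "inj_on normalizer_class T" "G = normalizer_class ` T"
      using G(1) unfolding subset_image_inj by blast
    have fin: "finite T" using G(2) T by (simp add: finite_image_iff)
    have "E (star (star u) * star v) = (if star u = star v then 1 else 0)" if "u \<in> T" "v \<in> T" for u v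
    proof (cases "u = v")
      case True
      then show ?thesis using T(1) that(1) by (auto simp: normalizer_cancel(2) E_id[OF B_closure(1)])
    next
      case False
      then have "normalizer_class u \<noteq> normalizer_class v" using T(2) that by (auto dest: inj_onD)
      then have "u * star v \<notin> H" using normalizer_class_eq_iff[of u v] T(1) that by blast
      moreover have "u * star v \<in> N" using T(1) that by (intro normalizer_mult normalizer_star) auto
      ultimately have "E (1 * (u * star v)) = 0" by (intro E_C_mult_outer C_closure(1))
      then show ?thesis using False by simp
    qed
    then have "orthonormal (star ` T)" using fin by (auto simp: orthonormal_def)
    moreover have "star ` T \<subseteq> unitaries UNIV"
      using T(1) normalizer_star normalizer_unitary by blast
    ultimately have "real (card (star ` T)) \<le> \<kappa>\<^sup>2" by (rule orthonormal_unitaries_card)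
    moreover have "card (star ` T) = card G"
      using T by (simp add: card_image inj_on_def)
    ultimately show ?thesis by (simp add: le_nat_floor)
  qed
  then show ?thesis using finite_if_finite_subsets_card_bdd by blast
qed

definition normalizer_group :: "'a monoid" where
  "normalizer_group = \<lparr>carrier = N, mult = (*), one = 1\<rparr>"

lemma normalizer_group_simps [simp]:
  "carrier normalizer_group = N" "mult normalizer_group = (*)" "one normalizer_group = 1"
  by (simp_all add: normalizer_group_def)

lemma group_normalizer_group: "group normalizer_group"
proof (rule groupI)
  fix x assume "x \<in> carrier normalizer_group"
  then show "\<exists>y\<in>carrier normalizer_group. y \<otimes>\<^bsub>normalizer_group\<^esub> x = \<one>\<^bsub>normalizer_group\<^esub>"
    by (intro bexI[of _ "star x"]) (simp_all add: normalizer_star normalizer_cancel)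
qed (simp_all add: normalizer_mult normalizer_one mult.assoc)

lemma inv_normalizer_group: "a \<in> N \<Longrightarrow> inv\<^bsub>normalizer_group\<^esub> a = star a"
  by (rule group.inv_equality[OF group_normalizer_group])
    (simp_all add: normalizer_star normalizer_cancel)

lemma H_normal: "H \<lhd> normalizer_group"
proof (rule group.normal_invI[OF group_normalizer_group])
  show "subgroup H normalizer_group"
  proof (rule group.subgroupI[OF group_normalizer_group])
    show "inv\<^bsub>normalizer_group\<^esub> a \<in> H" if a: "a \<in> H" for a
    proof -
      have "a \<in> N" using a H_subset_N by blast
      then show ?thesis using H_star[OF a] by (simp add: inv_normalizer_group)
    qed
    show "a \<otimes>\<^bsub>normalizer_group\<^esub> b \<in> H" if "a \<in> H" "b \<in> H" for a b
      using H_mult[OF that] by simp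
  qed (use H_subset_N H_one in auto)
  show "x \<otimes>\<^bsub>normalizer_group\<^esub> h \<otimes>\<^bsub>normalizer_group\<^esub> inv\<^bsub>normalizer_group\<^esub> x \<in> H"
    if "x \<in> carrier normalizer_group" "h \<in> H" for x h
    using H_conj[of h x] that by (simp add: inv_normalizer_group)
qed

end

section \<open>Regular inclusions are crossed products\<close>

text \<open>The function \<open>cls\<close> numbers the classes of normalizers, so that the quotient group is carried by
  natural numbers.\<close>

locale regular_normalizer_classes = centralizer_basis +
  fixes cls :: "'a \<Rightarrow> nat"
  assumes cls_eq_iff: "a \<in> N \<Longrightarrow> b \<in> N \<Longrightarrow> cls a = cls b \<longleftrightarrow> a * star b \<in> H"
    and finite_cls: "finite (cls ` N)"
    and regular: "regular_inclusion B"
begin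

definition G :: "nat monoid" where
  "G = image_group cls normalizer_group"

lemma weak_morphism: "weak_group_morphism cls H normalizer_group"
  by (rule weak_group_morphismsI[OF H_normal]) (simp add: cls_eq_iff inv_normalizer_group)

lemma G_group: "group G"
  unfolding G_def by (rule group.image_group_is_group[OF group_normalizer_group weak_morphism])

lemma G_carrier: "carrier G = cls ` N"
  by (simp add: G_def image_group_carrier)

lemma G_finite: "finite (carrier G)"
  by (simp add: G_carrier finite_cls)

lemma G_one: "\<one>\<^bsub>G\<^esub> = cls 1"
  by (simp add: G_def image_group_one)

lemma G_mult: "a \<in> N \<Longrightarrow> b \<in> N \<Longrightarrow> cls a \<otimes>\<^bsub>G\<^esub> cls b = cls (a * b)"
  using group.weak_group_morphism_is_hom[OF group_normalizer_group weak_morphism]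
  by (simp add: G_def hom_def)

text \<open>The unit represents its class, which makes \<open>\<sigma>(g,e) = \<sigma>(e,g) = 1\<close>.\<close>

definition rep :: "nat \<Rightarrow> 'a" where
  "rep g = (if g = \<one>\<^bsub>G\<^esub> then 1 else inv_into N cls g)"

lemma rep_one [simp]: "rep \<one>\<^bsub>G\<^esub> = 1"
  by (simp add: rep_def)

lemma rep_normalizer: "g \<in> carrier G \<Longrightarrow> rep g \<in> N"
  by (auto simp: rep_def G_carrier normalizer_one inv_into_into)

lemma cls_rep: "g \<in> carrier G \<Longrightarrow> cls (rep g) = g"
  by (auto simp: rep_def G_carrier G_one f_inv_into_f)

lemmas rep_cancel = normalizer_cancel[OF rep_normalizer]

lemma rep_mult_star_H_iff:
  assumes "g \<in> carrier G" "h \<in> carrier G"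
  shows "rep g * star (rep h) \<in> H \<longleftrightarrow> g = h"
  using cls_eq_iff[OF rep_normalizer[OF assms(1)] rep_normalizer[OF assms(2)]] assms
  by (simp add: cls_rep)

text \<open>Orthogonality of distinct classes: \<open>proj V\<close> reads off the coefficient of \<open>u\<^sub>h\<close>.\<close>

lemma proj_C_rep:
  assumes c: "c \<in> C" and g: "g \<in> carrier G" and h: "h \<in> carrier G"
  shows "proj V (c * rep g * star (rep h)) = (if g = h then c else 0)"
proof (cases "g = h")
  case True
  then show ?thesis using c h by (simp add: mult.assoc rep_cancel C_def)
next
  case False
  have "rep g * star (rep h) \<in> N" by (intro normalizer_mult normalizer_star rep_normalizer g h)
  with False show ?thesis
    using proj_C_mult_outer[of "rep g * star (rep h)" c] rep_mult_star_H_iff[OF g h] c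
    by (simp add: mult.assoc)
qed

definition \<Psi> :: "(nat \<Rightarrow> 'a) \<Rightarrow> 'a" where
  "\<Psi> X = (\<Sum>g\<in>carrier G. X g * rep g)"

definition \<Phi> :: "'a \<Rightarrow> nat \<Rightarrow> 'a" where
  "\<Phi> x = (\<lambda>g\<in>carrier G. proj V (x * star (rep g)))"

lemma \<Phi>_mem: "\<Phi> x \<in> carrier G \<rightarrow>\<^sub>E C"
  by (auto simp: \<Phi>_def proj_V_mem)

lemma \<Phi>_\<Psi>:
  assumes X: "X \<in> carrier G \<rightarrow>\<^sub>E C"
  shows "\<Phi> (\<Psi> X) = X"
proof
  fix h
  show "\<Phi> (\<Psi> X) h = X h"
  proof (cases "h \<in> carrier G")
    case True
    have "proj V (\<Psi> X * star (rep h)) = (\<Sum>g\<in>carrier G. if g = h then X g else 0)"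
      unfolding \<Psi>_def sum_distrib_right proj_sum
      by (intro sum.cong refl proj_C_rep PiE_mem[OF X] True)
    then show ?thesis using True G_finite by (simp add: \<Phi>_def)
  next
    case False
    then show ?thesis using PiE_arb[OF X False] by (simp add: \<Phi>_def)
  qed
qed

text \<open>The sums \<open>\<Sum>\<^sub>g x\<^sub>g u\<^sub>g\<close>, again described as fixed points of a bounded map in order to be closed.\<close>

definition D :: "'a set" where
  "D = {x. \<Psi> (\<Phi> x) = x}"

lemma \<Psi>_\<Phi>_eq: "\<Psi> (\<Phi> x) = (\<Sum>g\<in>carrier G. proj V (x * star (rep g)) * rep g)"
  by (simp add: \<Psi>_def \<Phi>_def)

lemma closed_D: "closed D"
proof -
  have "bounded_linear (\<lambda>x. \<Sum>g\<in>carrier G. proj V (x * star (rep g)) * rep g)"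
    by (intro bounded_linear_sum bounded_linear_mult_const
        bounded_linear_compose[OF bounded_linear_proj bounded_linear_mult_left])
  then show ?thesis
    unfolding D_def \<Psi>_\<Phi>_eq
    by (intro closed_Collect_eq continuous_intros linear_continuous_on)
qed

lemma D_sum:
  assumes "\<And>i. i \<in> I \<Longrightarrow> f i \<in> D"
  shows "sum f I \<in> D"
proof -
  have "\<Psi> (\<Phi> (sum f I)) = (\<Sum>i\<in>I. \<Psi> (\<Phi> (f i)))"
    unfolding \<Psi>_\<Phi>_eq sum_distrib_right proj_sum by (rule sum.swap)
  also have "\<dots> = sum f I" using assms by (intro sum.cong) (auto simp: D_def)
  finally show ?thesis by (simp add: D_def)
qed

lemma C_rep_in_D:
  assumes "c \<in> C" "g \<in> carrier G"
  shows "c * rep g \<in> D"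
proof -
  have "(\<Sum>h\<in>carrier G. proj V (c * rep g * star (rep h)) * rep h) =
      (\<Sum>h\<in>carrier G. if g = h then c * rep g else 0)"
    using assms by (intro sum.cong) (auto simp: proj_C_rep)
  then show ?thesis using assms G_finite by (simp add: D_def \<Psi>_\<Phi>_eq)
qed

text \<open>An element \<open>u \<in> N\<close> is \<open>(u u\<^sub>g\<^sup>*) u\<^sub>g\<close> with \<open>u u\<^sub>g\<^sup>* \<in> H \<subseteq> C\<close> for its class \<open>g\<close>.\<close>

lemma C_N_in_D:
  assumes c: "c \<in> C" and u: "u \<in> N"
  shows "c * u \<in> D"
proof -
  have g: "cls u \<in> carrier G" using u by (simp add: G_carrier)
  have "u * star (rep (cls u)) \<in> H"
    using cls_eq_iff[OF u rep_normalizer[OF g]] by (simp add: cls_rep[OF g])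
  then have "c * (u * star (rep (cls u))) \<in> C" by (intro C_closure(6)[OF c] subsetD[OF H_subset_C])
  from C_rep_in_D[OF this g] show ?thesis by (simp add: mult.assoc rep_cancel[OF g])
qed

lemma D_induct [consumes 1, case_names base sum]:
  assumes x: "x \<in> D"
    and base: "\<And>c u. c \<in> C \<Longrightarrow> u \<in> N \<Longrightarrow> P (c * u)"
    and sum: "\<And>f (I::nat set). (\<And>i. i \<in> I \<Longrightarrow> P (f i)) \<Longrightarrow> P (sum f I)"
  shows "P x"
proof -
  have "P (\<Sum>g\<in>carrier G. proj V (x * star (rep g)) * rep g)"
    by (intro sum base proj_V_mem rep_normalizer)
  then show ?thesis using x by (simp add: D_def \<Psi>_\<Phi>_eq)
qed

lemma D_subalgebra: "cstar_subalgebra D"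
proof -
  have two: "x + y \<in> D" if "x \<in> D" "y \<in> D" for x y
    using D_sum[of "{True, False}" "\<lambda>b. if b then x else y"] that by simp
  have scal: "c *\<^sub>C x \<in> D" if "x \<in> D" for c x
    using that
  proof (induction x rule: D_induct)
    case (base d u)
    from C_N_in_D[OF C_closure(8)[OF base(1)] base(2), of c] show ?case by simp
  next
    case (sum f I)
    then show ?case unfolding scaleC_sum_right by (rule D_sum)
  qed
  have mult: "x * y \<in> D" if "x \<in> D" "y \<in> D" for x y
    using that(1)
  proof (induction x rule: D_induct)
    case (base c u)
    show ?case using \<open>y \<in> D\<close>
    proof (induction y rule: D_induct)
      case (base d v)
      have "c * (u * d * star u) \<in> C"
        by (intro C_closure(6) C_conj base \<open>c \<in> C\<close> \<open>u \<in> N\<close>)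
      from C_N_in_D[OF this normalizer_mult[OF \<open>u \<in> N\<close> base(2)]]
      show ?case by (simp add: mult.assoc normalizer_cancel[OF \<open>u \<in> N\<close>])
    next
      case (sum f I)
      then show ?case unfolding sum_distrib_left by (rule D_sum)
    qed
  next
    case (sum f I)
    then show ?case unfolding sum_distrib_right by (rule D_sum)
  qed
  have star: "star x \<in> D" if "x \<in> D" for x
    using that
  proof (induction x rule: D_induct)
    case (base c u)
    from C_N_in_D[OF C_conj_star[OF base(2) C_closure(10)[OF base(1)]] normalizer_star[OF base(2)]]
    show ?case by (simp add: mult.assoc normalizer_cancel[OF base(2)])
  next
    case (sum f I)
    then show ?case by (simp add: D_sum)
  qed
  have "0 \<in> D" using D_sum[of "{}" id] by simp
  then show ?thesis
    unfolding cstar_subalgebra_def using closed_D two scal mult star by simp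
qed

text \<open>Regularity enters here: \<open>D\<close> is a C*-algebra containing \<open>N\<close>.\<close>

lemma \<Psi>_\<Phi>: "\<Psi> (\<Phi> x) = x"
proof -
  have "N \<subseteq> D" using C_N_in_D[OF C_closure(1)] by auto
  then have "cstar_generated N \<subseteq> D"
    unfolding cstar_generated_def using D_subalgebra by auto
  then show ?thesis using regular by (auto simp: regular_inclusion_def D_def)
qed

definition \<alpha> :: "nat \<Rightarrow> 'a \<Rightarrow> 'a" where
  "\<alpha> g x = rep g * x * star (rep g)"

definition \<sigma> :: "nat \<Rightarrow> nat \<Rightarrow> 'a" where
  "\<sigma> g h = rep g * rep h * star (rep (g \<otimes>\<^bsub>G\<^esub> h))"

lemma G_m_closed: "g \<in> carrier G \<Longrightarrow> h \<in> carrier G \<Longrightarrow> g \<otimes>\<^bsub>G\<^esub> h \<in> carrier G"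
  by (rule monoid.m_closed[OF group.is_monoid[OF G_group]])

lemma \<sigma>_mem:
  assumes g: "g \<in> carrier G" and h: "h \<in> carrier G"
  shows "\<sigma> g h \<in> C" "\<sigma> g h \<in> unitaries C"
proof -
  note gh = G_m_closed[OF g h]
  have "cls (rep g * rep h) = g \<otimes>\<^bsub>G\<^esub> h"
    using G_mult[OF rep_normalizer[OF g] rep_normalizer[OF h]] by (simp add: cls_rep g h)
  then have "\<sigma> g h \<in> H"
    unfolding \<sigma>_def
    using cls_eq_iff[OF normalizer_mult[OF rep_normalizer[OF g] rep_normalizer[OF h]] rep_normalizer[OF gh]]
    by (simp add: cls_rep[OF gh])
  then show "\<sigma> g h \<in> C" using H_subset_C by blast
  then show "\<sigma> g h \<in> unitaries C"
    by (simp add: unitaries_def) (simp add: \<sigma>_def mult.assoc rep_cancel g h gh)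
qed

lemma \<alpha>_C: "g \<in> carrier G \<Longrightarrow> c \<in> C \<Longrightarrow> \<alpha> g c \<in> C"
  unfolding \<alpha>_def by (intro C_conj rep_normalizer)

lemma \<alpha>_automorphism:
  assumes g: "g \<in> carrier G"
  shows "automorphism C (\<alpha> g)" "automorphism B (\<alpha> g)" "\<alpha> g ` B = B"
proof -
  note u = rep_normalizer[OF g]
  have \<alpha>: "\<alpha> g = (\<lambda>x. rep g * x * star (rep g))" by (rule ext) (simp add: \<alpha>_def)
  show B: "\<alpha> g ` B = B" using u by (simp add: \<alpha> normalizer_def)
  show "automorphism C (\<alpha> g)"
    unfolding \<alpha>
    by (intro automorphism_conj[OF normalizer_unitary[OF u]]
        conj_image_eqI[OF normalizer_unitary[OF u]] C_conj[OF u] C_conj_star[OF u])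
  show "automorphism B (\<alpha> g)"
    unfolding \<alpha> by (intro automorphism_conj[OF normalizer_unitary[OF u]]) (use B \<alpha> in simp)
qed

lemma \<alpha>_outer:
  assumes g: "g \<in> carrier G" "g \<noteq> \<one>\<^bsub>G\<^esub>"
  shows "outer_automorphism B (\<alpha> g)"
  unfolding outer_automorphism_def
proof
  show "automorphism B (\<alpha> g)" by (rule \<alpha>_automorphism(2)[OF g(1)])
  show "\<not> inner_automorphism B (\<alpha> g)"
  proof
    assume "inner_automorphism B (\<alpha> g)"
    then have "rep g \<in> H"
      using rep_normalizer[OF g(1)] by (simp add: H_def inner_automorphism_def \<alpha>_def)
    then have "cls (rep g) = cls 1"
      using cls_eq_iff[OF rep_normalizer[OF g(1)] normalizer_one] by simp
    then show False using g by (simp add: cls_rep G_one)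
  qed
qed

lemma cocycle: "cocycle_action G C \<alpha> \<sigma>"
  unfolding cocycle_action_def
proof (intro conjI ballI)
  fix g h k assume g: "g \<in> carrier G" and h: "h \<in> carrier G" and k: "k \<in> carrier G"
  note closed = G_m_closed[OF g h] G_m_closed[OF h k]
  have assoc: "(g \<otimes>\<^bsub>G\<^esub> h) \<otimes>\<^bsub>G\<^esub> k = g \<otimes>\<^bsub>G\<^esub> (h \<otimes>\<^bsub>G\<^esub> k)"
    by (rule monoid.m_assoc[OF group.is_monoid[OF G_group] g h k])
  show "\<sigma> g h * \<sigma> (g \<otimes>\<^bsub>G\<^esub> h) k = \<alpha> g (\<sigma> h k) * \<sigma> g (h \<otimes>\<^bsub>G\<^esub> k)"
    by (simp add: \<sigma>_def \<alpha>_def assoc mult.assoc rep_cancel[OF g] rep_cancel[OF closed(1)]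
        rep_cancel[OF closed(2)])
next
  fix g h x assume g: "g \<in> carrier G" and h: "h \<in> carrier G" and "x \<in> C"
  show "\<alpha> g (\<alpha> h x) = \<sigma> g h * \<alpha> (g \<otimes>\<^bsub>G\<^esub> h) x * star (\<sigma> g h)"
    by (simp add: \<sigma>_def \<alpha>_def mult.assoc rep_cancel[OF G_m_closed[OF g h]])
next
  fix g assume g: "g \<in> carrier G"
  show "\<sigma> g \<one>\<^bsub>G\<^esub> = 1" "\<sigma> \<one>\<^bsub>G\<^esub> g = 1"
    by (simp_all add: \<sigma>_def rep_cancel[OF g] group.is_monoid[OF G_group] monoid.r_one[OF group.is_monoid[OF G_group] g]
        monoid.l_one[OF group.is_monoid[OF G_group] g])
qed (auto intro: \<alpha>_automorphism \<sigma>_mem)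

lemma \<Psi>_mult:
  assumes X: "X \<in> carrier G \<rightarrow>\<^sub>E C" and Y: "Y \<in> carrier G \<rightarrow>\<^sub>E C"
  shows "\<Psi> (cp_mult G \<alpha> \<sigma> X Y) = \<Psi> X * \<Psi> Y"
proof -
  interpret G: group G by (rule G_group)
  let ?t = "\<lambda>g k. X g * \<alpha> g (Y (inv\<^bsub>G\<^esub> g \<otimes>\<^bsub>G\<^esub> k)) * \<sigma> g (inv\<^bsub>G\<^esub> g \<otimes>\<^bsub>G\<^esub> k) * rep k"
  have "\<Psi> (cp_mult G \<alpha> \<sigma> X Y) = (\<Sum>k\<in>carrier G. \<Sum>g\<in>carrier G. ?t g k)"
    by (simp add: \<Psi>_def cp_mult_def sum_distrib_right)
  also have "\<dots> = (\<Sum>g\<in>carrier G. \<Sum>k\<in>carrier G. ?t g k)" by (rule sum.swap)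
  \<comment> \<open>Substituting \<open>k = g h\<close>, the term is \<open>x\<^sub>g (u\<^sub>g y\<^sub>h u\<^sub>g\<^sup>*) (u\<^sub>g u\<^sub>h u\<^sub>g\<^sub>h\<^sup>*) u\<^sub>g\<^sub>h\<close>.\<close>
  also have "\<dots> = (\<Sum>g\<in>carrier G. \<Sum>h\<in>carrier G. X g * rep g * (Y h * rep h))"
  proof (rule sum.cong[OF refl])
    fix g assume g: "g \<in> carrier G"
    have "(\<Sum>k\<in>carrier G. ?t g k) = (\<Sum>h\<in>carrier G. ?t g (g \<otimes>\<^bsub>G\<^esub> h))"
      by (rule sum.reindex_bij_witness[where i = "\<lambda>h. g \<otimes>\<^bsub>G\<^esub> h" and j = "\<lambda>k. inv\<^bsub>G\<^esub> g \<otimes>\<^bsub>G\<^esub> k"])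
        (use g in \<open>simp_all add: G.m_assoc[symmetric]\<close>)
    also have "\<dots> = (\<Sum>h\<in>carrier G. X g * rep g * (Y h * rep h))"
    proof (rule sum.cong[OF refl])
      fix h assume h: "h \<in> carrier G"
      have "inv\<^bsub>G\<^esub> g \<otimes>\<^bsub>G\<^esub> (g \<otimes>\<^bsub>G\<^esub> h) = h" using g h by (simp add: G.m_assoc[symmetric])
      then show "?t g (g \<otimes>\<^bsub>G\<^esub> h) = X g * rep g * (Y h * rep h)"
        by (simp add: \<alpha>_def \<sigma>_def mult.assoc rep_cancel[OF g] rep_cancel[OF G_m_closed[OF g h]])
    qed
    finally show "(\<Sum>k\<in>carrier G. ?t g k) = (\<Sum>h\<in>carrier G. X g * rep g * (Y h * rep h))" .
  qed
  also have "\<dots> = \<Psi> X * \<Psi> Y" by (simp add: \<Psi>_def sum_product)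
  finally show ?thesis .
qed

lemma \<Psi>_star:
  assumes X: "X \<in> carrier G \<rightarrow>\<^sub>E C"
  shows "\<Psi> (cp_star G \<alpha> \<sigma> X) = star (\<Psi> X)"
proof -
  interpret G: group G by (rule G_group)
  let ?t = "\<lambda>k. star (\<sigma> k (inv\<^bsub>G\<^esub> k)) * \<alpha> k (star (X (inv\<^bsub>G\<^esub> k))) * rep k"
  have "\<Psi> (cp_star G \<alpha> \<sigma> X) = (\<Sum>k\<in>carrier G. ?t k)" by (simp add: \<Psi>_def cp_star_def)
  also have "\<dots> = (\<Sum>g\<in>carrier G. ?t (inv\<^bsub>G\<^esub> g))"
    by (rule sum.reindex_bij_witness[where i = "\<lambda>g. inv\<^bsub>G\<^esub> g" and j = "\<lambda>k. inv\<^bsub>G\<^esub> k"]) simp_all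
  also have "\<dots> = (\<Sum>g\<in>carrier G. star (X g * rep g))"
  proof (rule sum.cong[OF refl])
    fix g assume g: "g \<in> carrier G"
    then show "?t (inv\<^bsub>G\<^esub> g) = star (X g * rep g)"
      by (simp add: \<alpha>_def \<sigma>_def mult.assoc rep_cancel[OF G.inv_closed[OF g]])
  qed
  finally show ?thesis by (simp add: \<Psi>_def)
qed

lemma cp_mult_mem:
  assumes X: "X \<in> carrier G \<rightarrow>\<^sub>E C" and Y: "Y \<in> carrier G \<rightarrow>\<^sub>E C"
  shows "cp_mult G \<alpha> \<sigma> X Y \<in> carrier G \<rightarrow>\<^sub>E C"
proof -
  interpret G: group G by (rule G_group)
  have "X g * \<alpha> g (Y (inv\<^bsub>G\<^esub> g \<otimes>\<^bsub>G\<^esub> k)) * \<sigma> g (inv\<^bsub>G\<^esub> g \<otimes>\<^bsub>G\<^esub> k) \<in> C"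
    if "g \<in> carrier G" "k \<in> carrier G" for g k
    using X Y that by (intro C_closure(6) \<alpha>_C \<sigma>_mem(1)) auto
  then show ?thesis by (auto simp: cp_mult_def intro!: C_sum)
qed

lemma cp_star_mem:
  assumes X: "X \<in> carrier G \<rightarrow>\<^sub>E C"
  shows "cp_star G \<alpha> \<sigma> X \<in> carrier G \<rightarrow>\<^sub>E C"
proof -
  interpret G: group G by (rule G_group)
  have "star (\<sigma> k (inv\<^bsub>G\<^esub> k)) * \<alpha> k (star (X (inv\<^bsub>G\<^esub> k))) \<in> C" if "k \<in> carrier G" for k
    using X that by (intro C_closure(6,10) \<alpha>_C \<sigma>_mem(1)) auto
  then show ?thesis by (auto simp: cp_star_def)
qed

theorem crossed_product_iso:
  "inclusion_isomorphic B (cstar_of UNIV) (cp_embed G ` B) (crossed_product C G \<alpha> \<sigma>)"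
  unfolding inclusion_isomorphic_def
proof (intro exI conjI)
  have "bij_betw \<Phi> UNIV (carrier G \<rightarrow>\<^sub>E C)"
    by (rule bij_betw_byWitness[where f' = \<Psi>]) (simp_all add: \<Psi>_\<Phi> \<Phi>_\<Psi> \<Phi>_mem image_subset_iff)
  moreover have "\<Phi> (x + y) = (\<lambda>g\<in>carrier G. \<Phi> x g + \<Phi> y g)" for x y
    by (auto simp: \<Phi>_def distrib_right proj_add)
  moreover have "\<Phi> (c *\<^sub>C x) = (\<lambda>g\<in>carrier G. c *\<^sub>C \<Phi> x g)" for c x
    by (auto simp: \<Phi>_def proj_scaleC)
  moreover have "\<Phi> (x * y) = cp_mult G \<alpha> \<sigma> (\<Phi> x) (\<Phi> y)" for x y
    using \<Phi>_\<Psi>[OF cp_mult_mem[OF \<Phi>_mem \<Phi>_mem], of x y] by (simp add: \<Psi>_mult[OF \<Phi>_mem \<Phi>_mem] \<Psi>_\<Phi>)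
  moreover have "\<Phi> (star x) = cp_star G \<alpha> \<sigma> (\<Phi> x)" for x
    using \<Phi>_\<Psi>[OF cp_star_mem[OF \<Phi>_mem], of x] by (simp add: \<Psi>_star[OF \<Phi>_mem] \<Psi>_\<Phi>)
  ultimately show "star_isomorphism (cstar_of UNIV) (crossed_product C G \<alpha> \<sigma>) \<Phi>"
    unfolding star_isomorphism_def cstar_of_def crossed_product_def by simp
  have "\<Phi> b = cp_embed G b" if "b \<in> B" for b
  proof -
    interpret G: group G by (rule G_group)
    have "b \<in> C" using that B_subset_C by blast
    from proj_C_rep[OF this G.one_closed] show ?thesis
      by (auto simp: \<Phi>_def cp_embed_def)
  qed
  then show "\<Phi> ` B = cp_embed G ` B" by (intro image_cong) auto
qed

end

lemma (in centralizer_basis) regular_imp_crossed_product: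
  assumes "regular_inclusion B"
  shows "\<exists>(G :: nat monoid) \<alpha> \<sigma>.
       group G \<and> finite (carrier G) \<and> cocycle_action G C \<alpha> \<sigma> \<and>
       (\<forall>g\<in>carrier G. \<alpha> g ` B = B) \<and>
       (\<forall>g\<in>carrier G. g \<noteq> \<one>\<^bsub>G\<^esub> \<longrightarrow> outer_automorphism B (\<alpha> g)) \<and>
       inclusion_isomorphic B (cstar_of UNIV)
         (cp_embed G ` B) (crossed_product C G \<alpha> \<sigma>)"
proof -
  obtain enum :: "'a set \<Rightarrow> nat" where enum: "inj_on enum (normalizer_class ` N)"
    using finite_imp_inj_to_nat_seg[OF finite_normalizer_classes] by blast
  interpret regular_normalizer_classes B E n l V "enum \<circ> normalizer_class"
  proof
    show "(enum \<circ> normalizer_class) a = (enum \<circ> normalizer_class) b \<longleftrightarrow> a * star b \<in> H"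
      if "a \<in> N" "b \<in> N" for a b
      using inj_on_eq_iff[OF enum, of "normalizer_class a" "normalizer_class b"]
        normalizer_class_eq_iff[OF that] that by simp
    show "finite ((enum \<circ> normalizer_class) ` N)"
      unfolding image_comp[symmetric] by (rule finite_imageI[OF finite_normalizer_classes])
  qed (rule assms)
  show ?thesis
    using G_group G_finite cocycle \<alpha>_automorphism(3) \<alpha>_outer crossed_product_iso by blast
qed

section \<open>Crossed products are regular inclusions\<close>

lemma cstar_generated_superset: "X \<subseteq> cstar_generated X"
  by (auto simp: cstar_generated_def)

lemma cstar_generated_least: "cstar_subalgebra S \<Longrightarrow> X \<subseteq> S \<Longrightarrow> cstar_generated X \<subseteq> S"
  by (auto simp: cstar_generated_def)

lemma cstar_generated_subalgebra: "cstar_subalgebra (cstar_generated X)"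
  unfolding cstar_generated_def cstar_subalgebra_def by auto

locale crossed_product_inclusion = group G for G :: "'g monoid" (structure) +
  fixes B C :: "'a::cstar_algebra set"
    and \<alpha> :: "'g \<Rightarrow> 'a \<Rightarrow> 'a" and \<sigma> :: "'g \<Rightarrow> 'g \<Rightarrow> 'a" and \<phi> :: "'a \<Rightarrow> 'g \<Rightarrow> 'a"
  assumes B: "unital_cstar_subalgebra B"
    and C: "C = cstar_generated (B \<union> centralizer B)"
    and fin: "finite (carrier G)"
    and cocycle: "cocycle_action G C \<alpha> \<sigma>"
    and \<alpha>_B: "g \<in> carrier G \<Longrightarrow> \<alpha> g ` B = B"
    and iso: "star_isomorphism (cstar_of UNIV) (crossed_product C G \<alpha> \<sigma>) \<phi>"
    and \<phi>_B: "\<phi> ` B = cp_embed G ` B"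
begin

lemmas B_closure = unital_cstar_subalgebra_closure[OF B]

lemma B_subset_C: "B \<subseteq> C" and centralizer_subset_C: "centralizer B \<subseteq> C"
  using cstar_generated_superset[of "B \<union> centralizer B"] by (auto simp: C)

lemma C_unital: "unital_cstar_subalgebra C"
  using cstar_generated_subalgebra[of "B \<union> centralizer B"] B_subset_C B_closure(1)
  by (auto simp: C unital_cstar_subalgebra_def)

lemmas C_closure = unital_cstar_subalgebra_closure[OF C_unital]

lemma \<alpha>_hom:
  assumes g: "g \<in> carrier G"
  shows \<alpha>_bij: "bij_betw (\<alpha> g) C C"
    and \<alpha>_mult: "\<And>x y. x \<in> C \<Longrightarrow> y \<in> C \<Longrightarrow> \<alpha> g (x * y) = \<alpha> g x * \<alpha> g y"
    and \<alpha>_star: "\<And>x. x \<in> C \<Longrightarrow> \<alpha> g (star x) = star (\<alpha> g x)"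
    and \<alpha>_zero: "\<alpha> g 0 = 0"
proof -
  have "star_isomorphism (cstar_of C) (cstar_of C) (\<alpha> g)"
    using cocycle g by (simp add: cocycle_action_def automorphism_def)
  then have *: "bij_betw (\<alpha> g) C C \<and> (\<forall>x\<in>C. \<forall>y\<in>C. \<alpha> g (x * y) = \<alpha> g x * \<alpha> g y) \<and>
      (\<forall>x\<in>C. \<alpha> g (star x) = star (\<alpha> g x)) \<and> (\<forall>c. \<forall>x\<in>C. \<alpha> g (c *\<^sub>C x) = c *\<^sub>C \<alpha> g x)"
    by (simp add: star_isomorphism_def cstar_of_def)
  then show "bij_betw (\<alpha> g) C C" and "\<And>x y. x \<in> C \<Longrightarrow> y \<in> C \<Longrightarrow> \<alpha> g (x * y) = \<alpha> g x * \<alpha> g y"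
    and "\<And>x. x \<in> C \<Longrightarrow> \<alpha> g (star x) = star (\<alpha> g x)" by simp_all
  have "\<alpha> g (0 *\<^sub>C 0) = 0 *\<^sub>C \<alpha> g 0" using * C_closure(3) by blast
  then show "\<alpha> g 0 = 0" by simp
qed

lemma \<alpha>_mem: "g \<in> carrier G \<Longrightarrow> x \<in> C \<Longrightarrow> \<alpha> g x \<in> C"
  using \<alpha>_bij by (auto simp: bij_betw_def)

lemma \<alpha>_surj: "g \<in> carrier G \<Longrightarrow> x \<in> C \<Longrightarrow> \<exists>y\<in>C. \<alpha> g y = x"
  using \<alpha>_bij[of g] by (auto simp: bij_betw_def image_iff) (metis imageE)

lemma \<alpha>_unit:
  assumes g: "g \<in> carrier G"
  shows "\<alpha> g 1 = 1"
proof -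
  obtain y where y: "y \<in> C" "\<alpha> g y = 1" using \<alpha>_surj[OF g C_closure(1)] by blast
  have "\<alpha> g (1 * y) = \<alpha> g 1 * \<alpha> g y" by (rule \<alpha>_mult[OF g C_closure(1) y(1)])
  then show ?thesis by (simp add: y)
qed

lemma \<sigma>_unitary: "g \<in> carrier G \<Longrightarrow> h \<in> carrier G \<Longrightarrow> \<sigma> g h \<in> unitaries C"
  and \<sigma>_one: "g \<in> carrier G \<Longrightarrow> \<sigma> g \<one> = 1" "g \<in> carrier G \<Longrightarrow> \<sigma> \<one> g = 1"
  using cocycle by (auto simp: cocycle_action_def)

lemma \<sigma>_mem: "g \<in> carrier G \<Longrightarrow> h \<in> carrier G \<Longrightarrow> \<sigma> g h \<in> C"
  using \<sigma>_unitary by (auto simp: unitaries_def)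

text \<open>The cocycle identity for the triple \<open>(g, g\<^sup>-\<^sup>1, g)\<close>.\<close>

lemma \<sigma>_inv:
  assumes g: "g \<in> carrier G"
  shows "\<sigma> g (inv g) = \<alpha> g (\<sigma> (inv g) g)"
proof -
  have "\<sigma> g (inv g) * \<sigma> (g \<otimes> inv g) g = \<alpha> g (\<sigma> (inv g) g) * \<sigma> g (inv g \<otimes> g)"
    using cocycle g inv_closed[OF g] unfolding cocycle_action_def by blast
  then show ?thesis using g by (simp add: \<sigma>_one)
qed

lemma \<alpha>_one:
  assumes x: "x \<in> C"
  shows "\<alpha> \<one> x = x"
proof -
  obtain y where y: "y \<in> C" "\<alpha> \<one> y = x" using \<alpha>_surj[OF one_closed x] by blast
  have "\<alpha> \<one> (\<alpha> \<one> y) = \<sigma> \<one> \<one> * \<alpha> (\<one> \<otimes> \<one>) y * star (\<sigma> \<one> \<one>)"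
    using cocycle y(1) one_closed unfolding cocycle_action_def by blast
  then show ?thesis by (simp add: y \<sigma>_one)
qed

text \<open>The unitary \<open>u\<^sub>g\<close> of the crossed product as a family of coefficients.\<close>

definition U :: "'g \<Rightarrow> 'g \<Rightarrow> 'a" where
  "U g = (\<lambda>k\<in>carrier G. if k = g then 1 else 0)"

lemma U_mem: "U g \<in> carrier G \<rightarrow>\<^sub>E C"
  by (auto simp: U_def C_closure)

lemma embed_mem: "c \<in> C \<Longrightarrow> cp_embed G c \<in> carrier G \<rightarrow>\<^sub>E C"
  by (auto simp: cp_embed_def C_closure)

lemma cp_mult_embed:
  assumes X: "X \<in> carrier G \<rightarrow>\<^sub>E C"
  shows "cp_mult G \<alpha> \<sigma> (cp_embed G c) X = (\<lambda>k\<in>carrier G. c * X k)"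
proof -
  have "(\<Sum>g\<in>carrier G. cp_embed G c g * \<alpha> g (X (inv g \<otimes> k)) * \<sigma> g (inv g \<otimes> k)) = c * X k"
    if k: "k \<in> carrier G" for k
  proof -
    have "(\<Sum>g\<in>carrier G. cp_embed G c g * \<alpha> g (X (inv g \<otimes> k)) * \<sigma> g (inv g \<otimes> k)) =
        (\<Sum>g\<in>carrier G. if g = \<one> then c * X k else 0)"
      using k by (intro sum.cong) (auto simp: cp_embed_def \<alpha>_one PiE_mem[OF X] \<sigma>_one)
    then show ?thesis using fin by simp
  qed
  then show ?thesis by (auto simp: cp_mult_def)
qed

lemma cp_mult_U:
  assumes g: "g \<in> carrier G"
  shows "cp_mult G \<alpha> \<sigma> (U g) X =
    (\<lambda>k\<in>carrier G. \<alpha> g (X (inv g \<otimes> k)) * \<sigma> g (inv g \<otimes> k))"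
proof -
  have "(\<Sum>h\<in>carrier G. U g h * \<alpha> h (X (inv h \<otimes> k)) * \<sigma> h (inv h \<otimes> k)) =
      \<alpha> g (X (inv g \<otimes> k)) * \<sigma> g (inv g \<otimes> k)" for k
  proof -
    have "(\<Sum>h\<in>carrier G. U g h * \<alpha> h (X (inv h \<otimes> k)) * \<sigma> h (inv h \<otimes> k)) =
        (\<Sum>h\<in>carrier G. if h = g then \<alpha> g (X (inv g \<otimes> k)) * \<sigma> g (inv g \<otimes> k) else 0)"
      by (intro sum.cong) (auto simp: U_def)
    then show ?thesis using fin g by simp
  qed
  then show ?thesis by (auto simp: cp_mult_def)
qed

lemma inv_mult_eq_iff: "g \<in> carrier G \<Longrightarrow> k \<in> carrier G \<Longrightarrow> h \<in> carrier G \<Longrightarrow>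
    inv g \<otimes> k = h \<longleftrightarrow> k = g \<otimes> h"
  by (metis inv_closed inv_solve_left)

lemma cp_mult_U_embed:
  assumes g: "g \<in> carrier G" and c: "c \<in> C"
  shows "cp_mult G \<alpha> \<sigma> (U g) (cp_embed G c) = cp_mult G \<alpha> \<sigma> (cp_embed G (\<alpha> g c)) (U g)"
  unfolding cp_mult_U[OF g] cp_mult_embed[OF U_mem]
  using g by (intro restrict_ext) (auto simp: cp_embed_def U_def inv_mult_eq_iff \<sigma>_one \<alpha>_zero)

lemma cp_star_embed:
  assumes c: "c \<in> C"
  shows "cp_star G \<alpha> \<sigma> (cp_embed G c) = cp_embed G (star c)"
proof -
  have "star (\<sigma> k (inv k)) * \<alpha> k (star (cp_embed G c (inv k))) = (if k = \<one> then star c else 0)"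
    if k: "k \<in> carrier G" for k
  proof (cases "k = \<one>")
    case True
    then show ?thesis using c by (simp add: cp_embed_def \<sigma>_one \<alpha>_one C_closure)
  next
    case False
    then have "inv k \<noteq> \<one>" using k by (metis inv_inv inv_one)
    then show ?thesis using False k by (simp add: cp_embed_def \<alpha>_zero)
  qed
  then show ?thesis by (auto simp: cp_star_def cp_embed_def)
qed

lemma cp_star_U:
  assumes g: "g \<in> carrier G"
  shows "cp_star G \<alpha> \<sigma> (U g) =
    (\<lambda>k\<in>carrier G. if k = inv g then star (\<sigma> (inv g) g) else 0)"
proof -
  have "inv k = g \<longleftrightarrow> k = inv g" if "k \<in> carrier G" for k using g that by (metis inv_inv)
  then show ?thesis
    unfolding cp_star_def
    using g by (intro restrict_ext) (auto simp: U_def \<alpha>_zero \<alpha>_unit)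
qed

lemma cp_star_U_mem: "g \<in> carrier G \<Longrightarrow> cp_star G \<alpha> \<sigma> (U g) \<in> carrier G \<rightarrow>\<^sub>E C"
  unfolding cp_star_U by (auto simp: C_closure \<sigma>_mem)

lemma U_star_U:
  assumes g: "g \<in> carrier G"
  shows "cp_mult G \<alpha> \<sigma> (cp_star G \<alpha> \<sigma> (U g)) (U g) = cp_embed G 1"
proof -
  have "(\<Sum>h\<in>carrier G. cp_star G \<alpha> \<sigma> (U g) h * \<alpha> h (U g (inv h \<otimes> k)) * \<sigma> h (inv h \<otimes> k)) =
      (if k = \<one> then 1 else 0)" if k: "k \<in> carrier G" for k
  proof -
    have "(\<Sum>h\<in>carrier G. cp_star G \<alpha> \<sigma> (U g) h * \<alpha> h (U g (inv h \<otimes> k)) * \<sigma> h (inv h \<otimes> k)) =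
        (\<Sum>h\<in>carrier G. if h = inv g then
          star (\<sigma> (inv g) g) * \<alpha> (inv g) (U g (g \<otimes> k)) * \<sigma> (inv g) (g \<otimes> k) else 0)"
      using g by (intro sum.cong) (auto simp: cp_star_U)
    also have "\<dots> = star (\<sigma> (inv g) g) * \<alpha> (inv g) (U g (g \<otimes> k)) * \<sigma> (inv g) (g \<otimes> k)"
      using fin g by simp
    also have "\<dots> = (if k = \<one> then 1 else 0)"
    proof (cases "k = \<one>")
      case True
      then show ?thesis
        using g unitaries_cancel(1)[OF \<sigma>_unitary[of "inv g" g]] by (simp add: U_def \<alpha>_unit)
    next
      case False
      then have "g \<otimes> k \<noteq> g" using inv_mult_eq_iff[OF g g k] g by auto
      then show ?thesis using False g k by (simp add: U_def \<alpha>_zero)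
    qed
    finally show ?thesis .
  qed
  then show ?thesis by (auto simp: cp_mult_def cp_embed_def)
qed

lemma U_U_star:
  assumes g: "g \<in> carrier G"
  shows "cp_mult G \<alpha> \<sigma> (U g) (cp_star G \<alpha> \<sigma> (U g)) = cp_embed G 1"
proof -
  have "\<alpha> g (cp_star G \<alpha> \<sigma> (U g) (inv g \<otimes> k)) * \<sigma> g (inv g \<otimes> k) = (if k = \<one> then 1 else 0)"
    if k: "k \<in> carrier G" for k
  proof (cases "k = \<one>")
    case True
    have "\<alpha> g (star (\<sigma> (inv g) g)) = star (\<sigma> g (inv g))"
      using g by (simp add: \<alpha>_star \<sigma>_mem \<sigma>_inv)
    then show ?thesis
      using True g unitaries_cancel(1)[OF \<sigma>_unitary[of g "inv g"]] by (simp add: cp_star_U)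
  next
    case False
    then have "inv g \<otimes> k \<noteq> inv g" using g k by (simp add: inv_mult_eq_iff)
    then show ?thesis using False g k by (simp add: cp_star_U \<alpha>_zero)
  qed
  then show ?thesis unfolding cp_mult_U[OF g] cp_embed_def by (intro restrict_ext)
qed

lemma \<phi>_hom:
  shows \<phi>_bij: "bij_betw \<phi> UNIV (carrier G \<rightarrow>\<^sub>E C)"
    and \<phi>_add: "\<phi> (x + y) = (\<lambda>g\<in>carrier G. \<phi> x g + \<phi> y g)"
    and \<phi>_scal: "\<phi> (c *\<^sub>C x) = (\<lambda>g\<in>carrier G. c *\<^sub>C \<phi> x g)"
    and \<phi>_mult: "\<phi> (x * y) = cp_mult G \<alpha> \<sigma> (\<phi> x) (\<phi> y)"
    and \<phi>_star: "\<phi> (star x) = cp_star G \<alpha> \<sigma> (\<phi> x)"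
  using iso unfolding star_isomorphism_def cstar_of_def crossed_product_def by simp_all

lemma \<phi>_mem: "\<phi> x \<in> carrier G \<rightarrow>\<^sub>E C"
  using bij_betwE[OF \<phi>_bij] by blast

lemma \<phi>_sum: "finite I \<Longrightarrow> \<phi> (sum f I) = (\<lambda>g\<in>carrier G. \<Sum>i\<in>I. \<phi> (f i) g)"
proof (induction I rule: finite_induct)
  case empty
  show ?case using \<phi>_scal[of 0 0] by simp
next
  case (insert i I)
  then show ?case by (auto simp: \<phi>_add)
qed

definition \<psi> :: "('g \<Rightarrow> 'a) \<Rightarrow> 'a" where
  "\<psi> = inv_into UNIV \<phi>"

lemma \<psi>_\<phi>: "\<psi> (\<phi> x) = x"
  using \<phi>_bij by (simp add: \<psi>_def bij_betw_def)

lemma \<phi>_\<psi>: "X \<in> carrier G \<rightarrow>\<^sub>E C \<Longrightarrow> \<phi> (\<psi> X) = X"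
  using \<phi>_bij by (simp add: \<psi>_def bij_betw_def f_inv_into_f)

lemma \<psi>_mult:
  assumes "X \<in> carrier G \<rightarrow>\<^sub>E C" "Y \<in> carrier G \<rightarrow>\<^sub>E C"
  shows "\<psi> (cp_mult G \<alpha> \<sigma> X Y) = \<psi> X * \<psi> Y"
  using \<psi>_\<phi>[of "\<psi> X * \<psi> Y"] assms by (simp add: \<phi>_mult \<phi>_\<psi>)

lemma \<psi>_star:
  assumes "X \<in> carrier G \<rightarrow>\<^sub>E C"
  shows "\<psi> (cp_star G \<alpha> \<sigma> X) = star (\<psi> X)"
  using \<psi>_\<phi>[of "star (\<psi> X)"] assms by (simp add: \<phi>_star \<phi>_\<psi>)

text \<open>The copy of \<open>C\<close> in the crossed product, transported back to the ambient algebra. Its image is not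
  assumed to be \<open>C\<close>.\<close>

definition \<rho> :: "'a \<Rightarrow> 'a" where
  "\<rho> c = \<psi> (cp_embed G c)"

lemma \<rho>_add:
  assumes "x \<in> C" "y \<in> C"
  shows "\<rho> (x + y) = \<rho> x + \<rho> y"
proof -
  have "\<phi> (\<rho> x + \<rho> y) = cp_embed G (x + y)"
    unfolding \<phi>_add \<rho>_def \<phi>_\<psi>[OF embed_mem[OF assms(1)]] \<phi>_\<psi>[OF embed_mem[OF assms(2)]]
    by (auto simp: cp_embed_def)
  then show ?thesis using \<psi>_\<phi>[of "\<rho> x + \<rho> y"] by (simp add: \<rho>_def)
qed

lemma \<rho>_scal:
  assumes "x \<in> C"
  shows "\<rho> (c *\<^sub>C x) = c *\<^sub>C \<rho> x"
proof -
  have "\<phi> (c *\<^sub>C \<rho> x) = cp_embed G (c *\<^sub>C x)"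
    unfolding \<phi>_scal \<rho>_def \<phi>_\<psi>[OF embed_mem[OF assms]] by (auto simp: cp_embed_def)
  then show ?thesis using \<psi>_\<phi>[of "c *\<^sub>C \<rho> x"] by (simp add: \<rho>_def)
qed

lemma \<rho>_mult:
  assumes x: "x \<in> C" and y: "y \<in> C"
  shows "\<rho> (x * y) = \<rho> x * \<rho> y"
proof -
  have "cp_mult G \<alpha> \<sigma> (cp_embed G x) (cp_embed G y) = cp_embed G (x * y)"
    unfolding cp_mult_embed[OF embed_mem[OF y]] by (auto simp: cp_embed_def)
  then show ?thesis
    using \<psi>_mult[OF embed_mem[OF x] embed_mem[OF y]] by (simp add: \<rho>_def)
qed

lemma \<rho>_star: "x \<in> C \<Longrightarrow> \<rho> (star x) = star (\<rho> x)"
  using \<psi>_star[OF embed_mem] by (simp add: \<rho>_def cp_star_embed)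

lemma \<rho>_one: "\<rho> 1 = 1"
proof -
  have "\<phi> (\<rho> 1 * 1) = cp_mult G \<alpha> \<sigma> (cp_embed G 1) (\<phi> 1)"
    by (simp only: \<phi>_mult \<rho>_def \<phi>_\<psi>[OF embed_mem[OF C_closure(1)]])
  also have "\<dots> = \<phi> 1"
    using PiE_arb[OF \<phi>_mem[of 1]] by (auto simp: cp_mult_embed[OF \<phi>_mem])
  finally show ?thesis using \<psi>_\<phi>[of "\<rho> 1 * 1"] by (simp add: \<psi>_\<phi>)
qed

lemma \<rho>_norm: "x \<in> C \<Longrightarrow> norm (\<rho> x) \<le> norm x"
  by (rule star_hom_bounded[OF C_unital \<rho>_add \<rho>_scal \<rho>_mult \<rho>_star \<rho>_one])

lemma \<rho>_continuous: "continuous_on C \<rho>"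
proof (rule continuous_on_iff[THEN iffD2], intro ballI allI impI)
  fix x e :: 'a and \<epsilon> :: real assume "x \<in> C" "\<epsilon> > 0"
  have "dist (\<rho> y) (\<rho> x) \<le> dist y x" if y: "y \<in> C" for y
  proof -
    have "\<rho> y = \<rho> (y - x) + \<rho> x"
      using \<rho>_add[OF C_closure(5)[OF y \<open>x \<in> C\<close>] \<open>x \<in> C\<close>] by simp
    then show ?thesis using \<rho>_norm[OF C_closure(5)[OF y \<open>x \<in> C\<close>]] by (simp add: dist_norm)
  qed
  then show "\<exists>d>0. \<forall>y\<in>C. dist y x < d \<longrightarrow> dist (\<rho> y) (\<rho> x) < \<epsilon>"
    using \<open>\<epsilon> > 0\<close> by (intro exI[of _ \<epsilon>]) (auto intro: le_less_trans)
qed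

lemma \<rho>_B: "\<rho> ` B = B"
proof -
  have "\<rho> ` B = \<psi> ` (\<phi> ` B)" unfolding \<phi>_B by (auto simp: \<rho>_def)
  then show ?thesis by (simp add: image_comp \<psi>_\<phi> comp_def)
qed

lemma \<psi>_U_normalizer:
  assumes g: "g \<in> carrier G"
  shows "\<psi> (U g) \<in> normalizer B"
proof -
  define u where "u = \<psi> (U g)"
  have "star u * u = \<rho> 1" "u * star u = \<rho> 1"
    using \<psi>_mult[OF cp_star_U_mem[OF g] U_mem, of g] \<psi>_mult[OF U_mem cp_star_U_mem[OF g], of g]
    by (simp_all add: u_def \<rho>_def U_star_U U_U_star g \<psi>_star[OF U_mem])
  then have u: "u \<in> unitaries UNIV" by (simp add: unitaries_def \<rho>_one)
  have conj: "u * \<rho> b * star u = \<rho> (\<alpha> g b)" if b: "b \<in> B" for b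
  proof -
    have bC: "b \<in> C" "\<alpha> g b \<in> C" using b B_subset_C \<alpha>_mem[OF g] by auto
    have "u * \<rho> b = \<rho> (\<alpha> g b) * u"
      using \<psi>_mult[OF U_mem embed_mem[OF bC(1)], of g] \<psi>_mult[OF embed_mem[OF bC(2)] U_mem, of g]
      by (simp add: u_def \<rho>_def cp_mult_U_embed[OF g bC(1)])
    then show ?thesis by (simp add: mult.assoc unitaries_cancel[OF u])
  qed
  have "(\<lambda>b. u * b * star u) ` B = (\<lambda>b. u * b * star u) ` (\<rho> ` B)" by (simp only: \<rho>_B)
  also have "\<dots> = \<rho> ` (\<alpha> g ` B)" unfolding image_image using conj by (intro image_cong) auto
  also have "\<dots> = B" by (simp only: \<alpha>_B[OF g] \<rho>_B)
  finally show ?thesis using u by (simp add: normalizer_def u_def)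
qed

lemma expand: "x = (\<Sum>g\<in>carrier G. \<rho> (\<phi> x g) * \<psi> (U g))"
proof -
  have "\<phi> (\<rho> c * \<psi> (U g)) = (\<lambda>k\<in>carrier G. if k = g then c else 0)" if "c \<in> C" for c g
    unfolding \<phi>_mult \<rho>_def \<phi>_\<psi>[OF embed_mem[OF that]] \<phi>_\<psi>[OF U_mem] cp_mult_embed[OF U_mem]
    by (auto simp: U_def)
  then have "\<phi> (\<Sum>g\<in>carrier G. \<rho> (\<phi> x g) * \<psi> (U g)) =
      (\<lambda>k\<in>carrier G. \<Sum>g\<in>carrier G. if k = g then \<phi> x g else 0)"
    unfolding \<phi>_sum[OF fin] by (intro restrict_ext sum.cong) (auto simp: PiE_mem[OF \<phi>_mem])
  also have "\<dots> = \<phi> x" using fin PiE_arb[OF \<phi>_mem[of x]] by auto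
  finally show ?thesis by (metis \<psi>_\<phi>)
qed

text \<open>For a C*-subalgebra \<open>S\<close> containing the normalizer, the elements of \<open>C\<close> that \<open>\<rho>\<close> maps into \<open>S\<close> form
  a C*-algebra \<open>T\<close>. It contains \<open>B\<close> as \<open>\<rho>(B) = B\<close>, and it contains the centralizer since \<open>\<rho>\<close> maps
  unitaries of the centralizer to such unitaries. Thus \<open>T = C\<close>, and the expansion of an element
  in the crossed product shows that it lies in \<open>S\<close>.\<close>

theorem regular: "regular_inclusion B"
proof -
  have "x \<in> S" if S: "cstar_subalgebra S" and N: "normalizer B \<subseteq> S" for S x
  proof -
    note S_closure = cstar_subalgebra_closure[OF S]
    have BS: "B \<subseteq> S"
      using subset_of_unitaries_subset[OF B S] unitaries_subset_normalizer[OF B] N by blast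
    define T where "T = C \<inter> \<rho> -` S"
    have "closed T"
      unfolding T_def by (rule continuous_closed_preimage[OF \<rho>_continuous C_closure(2) S_closure(1)])
    moreover have "\<rho> 0 = 0" using \<rho>_scal[OF C_closure(3), of 0] by simp
    ultimately have T: "cstar_subalgebra T"
      unfolding cstar_subalgebra_def
      by (auto simp: T_def \<rho>_add \<rho>_scal \<rho>_mult \<rho>_star intro: C_closure S_closure)
    have "B \<subseteq> T" using B_subset_C \<rho>_B BS by (auto simp: T_def)
    moreover have "centralizer B \<subseteq> T"
    proof (rule subset_of_unitaries_subset[OF _ T])
      show "unital_cstar_subalgebra (centralizer B)"
        by (rule centralizer_unital_cstar_subalgebra) (rule B_closure)
      show "unitaries (centralizer B) \<subseteq> T"
      proof
        fix r assume r: "r \<in> unitaries (centralizer B)"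
        then have rC: "r \<in> C" "star r \<in> C" and rR: "r \<in> centralizer B"
          using centralizer_subset_C by (auto simp: unitaries_def intro: C_closure)
        have "\<rho> r * d = d * \<rho> r" if "d \<in> B" for d
        proof -
          have "d \<in> \<rho> ` B" using that by (simp only: \<rho>_B)
          then obtain b where b: "d = \<rho> b" "b \<in> B" by (rule imageE)
          have "b \<in> C" using b(2) B_subset_C by blast
          then show ?thesis
            using centralizer_commute[OF rR b(2)] rC(1) by (simp add: b(1) \<rho>_mult[symmetric])
        qed
        moreover have "star (\<rho> r) * \<rho> r = 1" "\<rho> r * star (\<rho> r) = 1"
          using rC unitaries_cancel(1,2)[OF r]
          by (simp_all add: \<rho>_star[symmetric] \<rho>_mult[symmetric] \<rho>_one)
        ultimately have "\<rho> r \<in> unitaries (centralizer B)" by (simp add: unitaries_def centralizer_def)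
        then show "r \<in> T"
          using centralizer_unitaries_subset_normalizer N rC(1) by (auto simp: T_def)
      qed
    qed
    ultimately have "C \<subseteq> T" using cstar_generated_least[OF T] by (simp add: C)
    then have "\<rho> (\<phi> x g) * \<psi> (U g) \<in> S" if "g \<in> carrier G" for g
      using PiE_mem[OF \<phi>_mem that] \<psi>_U_normalizer[OF that] N
      by (intro S_closure(5)) (auto simp: T_def)
    then have "(\<Sum>g\<in>carrier G. \<rho> (\<phi> x g) * \<psi> (U g)) \<in> S" by (rule S_closure(10))
    then show ?thesis by (simp only: expand[symmetric])
  qed
  then show ?thesis by (auto simp: regular_inclusion_def cstar_generated_def)
qed

end

section \<open>The characterization of regular inclusions\<close>

theorem theorem3p12:
  fixes B C :: "'a::cstar_algebra set"
  assumes "unital_cstar_subalgebra B"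
    and "simple_cstar (UNIV :: 'a set)"
    and "simple_cstar B"
    and "\<exists>E. conditional_expectation B E \<and> finite_index E"
    and "C = cstar_generated (B \<union> centralizer B)"
  shows "regular_inclusion B \<longleftrightarrow>
    (\<exists>(G :: nat monoid) \<alpha> \<sigma>.
       group G \<and> finite (carrier G) \<and> cocycle_action G C \<alpha> \<sigma> \<and>
       (\<forall>g\<in>carrier G. \<alpha> g ` B = B) \<and>
       (\<forall>g\<in>carrier G. g \<noteq> \<one>\<^bsub>G\<^esub> \<longrightarrow> outer_automorphism B (\<alpha> g)) \<and>
       inclusion_isomorphic B (cstar_of UNIV)
         (cp_embed G ` B) (crossed_product C G \<alpha> \<sigma>))"
proof
  assume regular: "regular_inclusion B"
  obtain E n l where E: "conditional_expectation B E"
      "\<forall>x. x = (\<Sum>i<(n::nat). E (x * l i) * star (l i))"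
    using assms(4) unfolding finite_index_def by blast
  interpret simple_finite_index_expectation B E n l
  proof
    show "x = (\<Sum>i<n. E (x * l i) * star (l i))" for x by (rule E(2)[rule_format])
  qed (fact assms(1,3) E(1))+
  obtain V where V: "orthonormal V" "V \<subseteq> R" "\<And>r. r \<in> R \<Longrightarrow> proj V r = r"
    by (rule centralizer_orthonormal_basis) blast
  interpret basis: centralizer_basis B E n l V by unfold_locales (fact V)+
  show "\<exists>(G :: nat monoid) \<alpha> \<sigma>.
       group G \<and> finite (carrier G) \<and> cocycle_action G C \<alpha> \<sigma> \<and>
       (\<forall>g\<in>carrier G. \<alpha> g ` B = B) \<and>
       (\<forall>g\<in>carrier G. g \<noteq> \<one>\<^bsub>G\<^esub> \<longrightarrow> outer_automorphism B (\<alpha> g)) \<and>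
       inclusion_isomorphic B (cstar_of UNIV)
         (cp_embed G ` B) (crossed_product C G \<alpha> \<sigma>)"
    using basis.regular_imp_crossed_product[OF regular] by (simp only: assms(5) basis.C_eq)
next
  assume "\<exists>(G :: nat monoid) \<alpha> \<sigma>.
       group G \<and> finite (carrier G) \<and> cocycle_action G C \<alpha> \<sigma> \<and>
       (\<forall>g\<in>carrier G. \<alpha> g ` B = B) \<and>
       (\<forall>g\<in>carrier G. g \<noteq> \<one>\<^bsub>G\<^esub> \<longrightarrow> outer_automorphism B (\<alpha> g)) \<and>
       inclusion_isomorphic B (cstar_of UNIV)
         (cp_embed G ` B) (crossed_product C G \<alpha> \<sigma>)"
  then show "regular_inclusion B"
  proof (elim exE conjE)
    fix G :: "nat monoid" and \<alpha> \<sigma>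
    assume G: "group G" "finite (carrier G)" "cocycle_action G C \<alpha> \<sigma>"
      and \<alpha>: "\<forall>g\<in>carrier G. \<alpha> g ` B = B"
      and iso: "inclusion_isomorphic B (cstar_of UNIV) (cp_embed G ` B) (crossed_product C G \<alpha> \<sigma>)"
    from iso obtain \<phi> where \<phi>:
      "star_isomorphism (cstar_of UNIV) (crossed_product C G \<alpha> \<sigma>) \<phi>" "\<phi> ` B = cp_embed G ` B"
      by (auto simp: inclusion_isomorphic_def)
    interpret group G by (rule G(1))
    interpret crossed_product_inclusion G B C \<alpha> \<sigma> \<phi>
    proof
      show "\<alpha> g ` B = B" if "g \<in> carrier G" for g using \<alpha> that by blast
    qed (fact assms(1,5) G(2,3) \<phi>)+
    show "regular_inclusion B" by (rule regular)
  qed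
qed

end
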